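(* Let $\Omega\subset\mathbb{R}^d$ be a bounded $C^2$ domain equipped with heterogeneous localization functions $\eta_\delta$, $0<\delta<\delta_0$, and let $\rho$ be an admissible kernel (as defined in the context). Then there exists a constant $C$ depending only on $d$, $\rho$ and $\Omega$ such that for every $\delta\in(0,\delta_0)$: $$C^{-1}B_{\rho,\delta}(u,u)\le[u]^2_{\mathfrak{W}^{\delta,2}(\Omega)}\le C\,B_{\rho,\delta}(u,u)\qquad\text{for all }u\in\mathfrak{W}^{\delta,2}(\Omega);$$ moreover $$B_{\rho,\delta}(u,v)\le C\|u\|_{\mathfrak{W}^{\delta,2}(\Omega)}\|v\|_{\mathfrak{W}^{\delta,2}(\Omega)}\qquad\text{for all }u,v\in\mathfrak{W}^{\delta,2}(\Omega),$$ and, with $\underline\rho(r):=-\rho'(r)/r$, $$B_{\underline\rho,\delta}(u,v)\le C\|u\|_{\mathfrak{W}^{\delta,2}(\Omega)}\|v\|_{\mathfrak{W}^{\delta,2}(\Omega)}\qquad\text{for all }u,v\in\mathfrak{W}^{\delta,2}(\Omega).$$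
   Context: Domain and localization functions. $\Omega\subset\mathbb{R}^d$ is a bounded $C^2$ domain. There are constants $\kappa_0\in(0,1)$ and $\kappa_1,\kappa_2,\bar\kappa_0>0$ depending at most on $d$ and $\Omega$ and, with $\delta_0:=\min\{1,\frac{1}{9\kappa_1^2},\frac{1}{2\bar\kappa_0^2}\}$, for every $0<\delta<\delta_0$ a function $\eta_\delta:\overline\Omega\to[0,\infty)$, positive in $\Omega$, such that: (i) $\eta_\delta(x)=\operatorname{dist}(x,\partial\Omega)^2$ for $x\in\Omega$ with $\operatorname{dist}(x,\partial\Omega)^2<\kappa_0\delta$; (ii) $\eta_\delta(x)=\delta$ for $x\in\Omega$ with $\kappa_0\operatorname{dist}(x,\partial\Omega)^2>\delta$; (iii) $\eta_\delta\in C^2(\overline\Omega)$ with $|\nabla\eta_\delta|\le\kappa_1\sqrt\delta$ and $|\nabla^2\eta_\delta|\le\kappa_2$ in $\Omega$; (iv) $\eta_\delta(x)\le\bar\kappa_0\min\{\delta,\operatorname{dist}(x,\partial\Omega)^2\}$ in $\Omega$. These data are fixed with $\Omega$; a constant "depending on $\Omega$" may depend on $\kappa_0,\kappa_1,\kappa_2,\bar\kappa_0$ but not on $\delta$. Kernel. $\rho:[0,\infty)\to[0,\infty)$ is admissible if there are constants $0<\rho_0<\infty$ and $0<r_0<R_0<1$ such that $\rho\in C^1([0,\infty))$, $\rho\ge0$, $\lim_{r\to0^+}\rho'(r)/r$ exists, $\operatorname{supp}\rho\subset[0,R_0)$, and $\rho(r)\ge\rho_0$ for all $r\in[0,r_0]$.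 The function $\underline\rho$ is extended to $r=0$ by its limit. For a kernel function $\tilde\rho$ (either $\rho$ or $\underline\rho$) and $\alpha\in\mathbb{R}$ set $\tilde\rho_{\delta,\alpha}(x,y):=\frac12\Big[\frac{1}{\eta_\delta(x)^{d+\alpha}}\tilde\rho\big(\tfrac{|y-x|}{\eta_\delta(x)}\big)+\frac{1}{\eta_\delta(y)^{d+\alpha}}\tilde\rho\big(\tfrac{|y-x|}{\eta_\delta(y)}\big)\Big]$ and $B_{\tilde\rho,\delta}(u,v):=\int_\Omega\int_\Omega\tilde\rho_{\delta,2}(x,y)(u(x)-u(y))(v(x)-v(y))\,dy\,dx$. Function space. Fix a constant $R\in(0,1)$ (constants may depend on this fixed choice). $[u]_{\mathfrak{W}^{\delta,2}(\Omega)}^2:=\int_\Omega\int_{\Omega\cap\{|y-x|\le R\eta_\delta(x)\}}\frac{|u(x)-u(y)|^2}{\eta_\delta(x)^{d+2}}\,dy\,dx$, $\|u\|_{\mathfrak{W}^{\delta,2}(\Omega)}^2:=\|u\|_{L^2(\Omega)}^2+[u]_{\mathfrak{W}^{\delta,2}(\Omega)}^2$, and $\mathfrak{W}^{\delta,2}(\Omega)$ is the closure of $C^\infty(\overline\Omega)$ in this norm. *)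

theory Defs
  imports "HOL-Analysis.Analysis"
begin

text \<open>
  Euclidean space of dimension \<open>d\<close> is a type of class \<open>euclidean_space\<close>, with \<open>d = DIM('a)\<close>.
\<close>

primrec partials :: "'a::euclidean_space list \<Rightarrow> ('a \<Rightarrow> real) \<Rightarrow> 'a \<Rightarrow> real" where
  "partials [] f = f"
| "partials (b # bs) f = partials bs (\<lambda>x. frechet_derivative f (at x) b)"

definition C_k_on :: "nat \<Rightarrow> 'a::euclidean_space set \<Rightarrow> ('a \<Rightarrow> real) \<Rightarrow> bool" where
  "C_k_on k U f \<longleftrightarrow>
     (\<forall>bs. set bs \<subseteq> Basis \<and> length bs < k \<longrightarrow> (\<forall>x\<in>U. partials bs f differentiable (at x))) \<and>
     (\<forall>bs. set bs \<subseteq> Basis \<and> length bs \<le> k \<longrightarrow> continuous_on U (partials bs f))"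

text \<open>
  \<open>C\<^sup>k\<close> up to the boundary: all partial derivatives of order at most \<open>k\<close> extend continuously from the
  open set \<open>U\<close> to its closure (and the extension of the function itself is the function).
\<close>

definition C_k_closure :: "nat \<Rightarrow> 'a::euclidean_space set \<Rightarrow> ('a \<Rightarrow> real) \<Rightarrow> bool" where
  "C_k_closure k U f \<longleftrightarrow>
     C_k_on k U f \<and> continuous_on (closure U) f \<and>
     (\<forall>bs. set bs \<subseteq> Basis \<and> length bs \<le> k \<longrightarrow>
        (\<exists>g. continuous_on (closure U) g \<and> (\<forall>x\<in>U. g x = partials bs f x)))"

definition smooth_closure :: "'a::euclidean_space set \<Rightarrow> ('a \<Rightarrow> real) set" where
  "smooth_closure U = {f. \<forall>k. C_k_closure k U f}"

definition grad :: "('a::euclidean_space \<Rightarrow> real) \<Rightarrow> 'a \<Rightarrow> 'a" where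
  "grad f x = (\<Sum>b\<in>Basis. partials [b] f x *\<^sub>R b)"

text \<open>The Frobenius norm of the Hessian matrix.\<close>

definition hess_norm :: "('a::euclidean_space \<Rightarrow> real) \<Rightarrow> 'a \<Rightarrow> real" where
  "hess_norm f x = sqrt (\<Sum>b\<in>Basis. \<Sum>c\<in>Basis. (partials [b, c] f x)\<^sup>2)"

text \<open>
  Near each boundary point the domain is, after a rotation of the axes, the region above the graph
  of a \<open>C\<^sup>2\<close> function. The vector \<open>e\<close> is the vertical direction and \<open>x - (x \<bullet> e) *\<^sub>R e\<close> the
  horizontal part of \<open>x\<close>; \<open>\<gamma>\<close> is evaluated at horizontal vectors only, so requiring it to be \<open>C\<^sup>2\<close> on
  the whole space amounts to requiring this on the hyperplane orthogonal to \<open>e\<close>.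
\<close>

definition bounded_C2_domain :: "'a::euclidean_space set \<Rightarrow> bool" where
  "bounded_C2_domain \<Omega> \<longleftrightarrow>
     open \<Omega> \<and> connected \<Omega> \<and> \<Omega> \<noteq> {} \<and> bounded \<Omega> \<and>
     (\<forall>p\<in>frontier \<Omega>. \<exists>r>0. \<exists>e \<gamma>. norm e = 1 \<and> C_k_on 2 UNIV \<gamma> \<and>
        \<Omega> \<inter> ball p r = {x \<in> ball p r. x \<bullet> e > \<gamma> (x - (x \<bullet> e) *\<^sub>R e)})"

definition delta0 :: "real \<Rightarrow> real \<Rightarrow> real" where
  "delta0 \<kappa>\<^sub>1 \<kappa>\<^sub>b = Min {1, 1 / (9 * \<kappa>\<^sub>1\<^sup>2), 1 / (2 * \<kappa>\<^sub>b\<^sup>2)}"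

text \<open>The argument \<open>\<kappa>\<^sub>b\<close> is the constant usually written \<open>\<kappa>\<^sub>0\<close> with a bar.\<close>

definition localization_functions ::
  "'a::euclidean_space set \<Rightarrow> real \<Rightarrow> real \<Rightarrow> real \<Rightarrow> real \<Rightarrow> (real \<Rightarrow> 'a \<Rightarrow> real) \<Rightarrow> bool" where
  "localization_functions \<Omega> \<kappa>\<^sub>0 \<kappa>\<^sub>1 \<kappa>\<^sub>2 \<kappa>\<^sub>b \<eta> \<longleftrightarrow>
     (\<forall>\<delta>. 0 < \<delta> \<and> \<delta> < delta0 \<kappa>\<^sub>1 \<kappa>\<^sub>b \<longrightarrow>
        (\<forall>x\<in>closure \<Omega>. 0 \<le> \<eta> \<delta> x) \<and>
        (\<forall>x\<in>\<Omega>. 0 < \<eta> \<delta> x) \<and>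
        (\<forall>x\<in>\<Omega>. (infdist x (frontier \<Omega>))\<^sup>2 < \<kappa>\<^sub>0 * \<delta> \<longrightarrow> \<eta> \<delta> x = (infdist x (frontier \<Omega>))\<^sup>2) \<and>
        (\<forall>x\<in>\<Omega>. \<kappa>\<^sub>0 * (infdist x (frontier \<Omega>))\<^sup>2 > \<delta> \<longrightarrow> \<eta> \<delta> x = \<delta>) \<and>
        C_k_closure 2 \<Omega> (\<eta> \<delta>) \<and>
        (\<forall>x\<in>\<Omega>. norm (grad (\<eta> \<delta>) x) \<le> \<kappa>\<^sub>1 * sqrt \<delta>) \<and>
        (\<forall>x\<in>\<Omega>. hess_norm (\<eta> \<delta>) x \<le> \<kappa>\<^sub>2) \<and>
        (\<forall>x\<in>\<Omega>. \<eta> \<delta> x \<le> \<kappa>\<^sub>b * min \<delta> ((infdist x (frontier \<Omega>))\<^sup>2)))"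

text \<open>
  Kernels are functions on \<open>[0,\<infinity>)\<close>: only their values on \<open>{0..}\<close> are constrained and used, and the
  derivative at \<open>0\<close> is one-sided.
\<close>

definition kernel_deriv :: "(real \<Rightarrow> real) \<Rightarrow> real \<Rightarrow> real" where
  "kernel_deriv \<rho> r = vector_derivative \<rho> (at r within {0..})"

definition admissible_kernel :: "(real \<Rightarrow> real) \<Rightarrow> bool" where
  "admissible_kernel \<rho> \<longleftrightarrow>
     (\<exists>\<rho>\<^sub>0 r\<^sub>0 R\<^sub>0. 0 < \<rho>\<^sub>0 \<and> 0 < r\<^sub>0 \<and> r\<^sub>0 < R\<^sub>0 \<and> R\<^sub>0 < 1 \<and>
        \<rho> differentiable_on {0..} \<and> continuous_on {0..} (kernel_deriv \<rho>) \<and>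
        (\<forall>r\<ge>0. 0 \<le> \<rho> r) \<and>
        (\<exists>l. ((\<lambda>r. kernel_deriv \<rho> r / r) \<longlongrightarrow> l) (at_right 0)) \<and>
        closure {r \<in> {0..}. \<rho> r \<noteq> 0} \<subseteq> {0..<R\<^sub>0} \<and>
        (\<forall>r\<in>{0..r\<^sub>0}. \<rho>\<^sub>0 \<le> \<rho> r))"

definition derived_kernel :: "(real \<Rightarrow> real) \<Rightarrow> real \<Rightarrow> real" where
  "derived_kernel \<rho> r =
     (if r = 0 then Lim (at_right 0) (\<lambda>s. - kernel_deriv \<rho> s / s) else - kernel_deriv \<rho> r / r)"

text \<open>Below, \<open>h\<close> stands for the localization function at a fixed \<open>\<delta>\<close>.\<close>

definition scaled_kernel ::
  "(real \<Rightarrow> real) \<Rightarrow> ('a::euclidean_space \<Rightarrow> real) \<Rightarrow> real \<Rightarrow> 'a \<Rightarrow> 'a \<Rightarrow> real" where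
  "scaled_kernel k h \<alpha> x y =
     1 / 2 * (1 / h x powr (real DIM('a) + \<alpha>) * k (norm (y - x) / h x)
            + 1 / h y powr (real DIM('a) + \<alpha>) * k (norm (y - x) / h y))"

definition form_integrand ::
  "(real \<Rightarrow> real) \<Rightarrow> ('a::euclidean_space \<Rightarrow> real) \<Rightarrow> ('a \<Rightarrow> real) \<Rightarrow> ('a \<Rightarrow> real) \<Rightarrow> 'a \<Rightarrow> 'a \<Rightarrow> real" where
  "form_integrand k h u v x y = scaled_kernel k h 2 x y * (u x - u y) * (v x - v y)"

definition nonlocal_form ::
  "'a::euclidean_space set \<Rightarrow> (real \<Rightarrow> real) \<Rightarrow> ('a \<Rightarrow> real) \<Rightarrow> ('a \<Rightarrow> real) \<Rightarrow> ('a \<Rightarrow> real) \<Rightarrow> real" where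
  "nonlocal_form \<Omega> k h u v =
     (LINT x|lebesgue_on \<Omega>. (LINT y|lebesgue_on \<Omega>. form_integrand k h u v x y))"

text \<open>
  Absolute convergence of the double integral. It is kept as a separate predicate because the
  Bochner integral of a non-integrable function is \<open>0\<close> by convention.
\<close>

definition form_converges ::
  "'a::euclidean_space set \<Rightarrow> (real \<Rightarrow> real) \<Rightarrow> ('a \<Rightarrow> real) \<Rightarrow> ('a \<Rightarrow> real) \<Rightarrow> ('a \<Rightarrow> real) \<Rightarrow> bool" where
  "form_converges \<Omega> k h u v \<longleftrightarrow>
     integrable (lebesgue_on \<Omega> \<Otimes>\<^sub>M lebesgue_on \<Omega>) (\<lambda>(x, y). form_integrand k h u v x y)"

definition L2_norm_sq :: "'a::euclidean_space set \<Rightarrow> ('a \<Rightarrow> real) \<Rightarrow> ennreal" where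
  "L2_norm_sq \<Omega> u = (\<integral>\<^sup>+x. ennreal ((u x)\<^sup>2) \<partial>lebesgue_on \<Omega>)"

definition W_seminorm_sq ::
  "'a::euclidean_space set \<Rightarrow> real \<Rightarrow> ('a \<Rightarrow> real) \<Rightarrow> ('a \<Rightarrow> real) \<Rightarrow> ennreal" where
  "W_seminorm_sq \<Omega> R h u =
     (\<integral>\<^sup>+x. (\<integral>\<^sup>+y. ennreal (\<bar>u x - u y\<bar>\<^sup>2 / h x ^ (DIM('a) + 2))
               \<partial>lebesgue_on (\<Omega> \<inter> {y. norm (y - x) \<le> R * h x})) \<partial>lebesgue_on \<Omega>)"

definition W_norm_sq ::
  "'a::euclidean_space set \<Rightarrow> real \<Rightarrow> ('a \<Rightarrow> real) \<Rightarrow> ('a \<Rightarrow> real) \<Rightarrow> ennreal" where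
  "W_norm_sq \<Omega> R h u = L2_norm_sq \<Omega> u + W_seminorm_sq \<Omega> R h u"

text \<open>On the space below the squared norms are finite, so the following real values are genuine.\<close>

definition W_seminorm ::
  "'a::euclidean_space set \<Rightarrow> real \<Rightarrow> ('a \<Rightarrow> real) \<Rightarrow> ('a \<Rightarrow> real) \<Rightarrow> real" where
  "W_seminorm \<Omega> R h u = sqrt (enn2real (W_seminorm_sq \<Omega> R h u))"

definition W_norm ::
  "'a::euclidean_space set \<Rightarrow> real \<Rightarrow> ('a \<Rightarrow> real) \<Rightarrow> ('a \<Rightarrow> real) \<Rightarrow> real" where
  "W_norm \<Omega> R h u = sqrt (enn2real (W_norm_sq \<Omega> R h u))"

text \<open>
  The closure of the smooth functions, taken inside the (complete) space of measurable functions of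
  finite norm. Elements are representatives rather than classes modulo null sets; their values
  outside \<open>\<Omega>\<close> are irrelevant.
\<close>

definition W_space :: "'a::euclidean_space set \<Rightarrow> real \<Rightarrow> ('a \<Rightarrow> real) \<Rightarrow> ('a \<Rightarrow> real) set" where
  "W_space \<Omega> R h =
     {u. u \<in> borel_measurable (lebesgue_on \<Omega>) \<and> W_norm_sq \<Omega> R h u < \<infinity> \<and>
         (\<forall>\<epsilon>>0. \<exists>\<phi>\<in>smooth_closure \<Omega>. W_norm_sq \<Omega> R h (\<lambda>x. u x - \<phi> x) < ennreal (\<epsilon>\<^sup>2))}"

end

theory Submission
  imports Defs
begin

text \<open>
  The kernels are bounded and supported in \<open>[0, 1)\<close>, and \<open>\<rho>\<close> is bounded below near \<open>0\<close>, so by the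
  symmetry of the double integral the forms are controlled by the seminorm with horizon \<open>1\<close>, while
  \<open>B\<^sub>\<rho>\<close> controls the seminorm with some small horizon \<open>r\<^sub>0\<close>; the mixed forms then follow from
  Cauchy--Schwarz. It remains to see that the seminorms with different horizons in \<open>(0, 1]\<close> are
  equivalent. For this, split \<open>u x - u y\<close> at the midpoint \<open>m\<close> of \<open>x\<close> and \<open>y\<close>. If
  \<open>\<bar>x - y\<bar> \<le> s \<eta>(x)\<close>, then \<open>\<bar>x - m\<bar>\<close> and \<open>\<bar>y - m\<bar>\<close> are at most \<open>3/4 s\<close> times \<open>\<eta>(x)\<close> and
  \<open>\<eta>(y)\<close> respectively, because \<open>\<eta>\<close> has Lipschitz constant \<open>1/3\<close> and hence \<open>\<eta>(y) \<ge> 2/3 \<eta>(x)\<close>.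
  The substitutions \<open>y = 2 m - x\<close> and \<open>x = 2 m - y\<close> bound the seminorm with horizon \<open>s\<close> by the one with
  horizon \<open>3/4 s\<close>, and this is iterated.
\<close>

subsection \<open>Comparison of horizons\<close>

lemma nn_integral_lborel_affine:
  fixes t :: "'a::euclidean_space"
  assumes [measurable]: "f \<in> borel_measurable borel" and "c \<noteq> 0"
  shows "(\<integral>\<^sup>+x. f x \<partial>lborel) = ennreal (\<bar>c\<bar> ^ DIM('a)) * (\<integral>\<^sup>+x. f (t + c *\<^sub>R x) \<partial>lborel)"
  by (subst lborel_affine[OF assms(2), of t])
     (simp add: nn_integral_density nn_integral_distr nn_integral_cmult)

lemma midpoint_square_le:
  fixes a b c :: real
  shows "(a - b)\<^sup>2 \<le> 2 * (a - c)\<^sup>2 + 2 * (c - b)\<^sup>2"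
proof -
  have "0 \<le> ((a - c) - (c - b))\<^sup>2" by simp
  then show ?thesis by (simp add: power2_eq_square algebra_simps)
qed

text \<open>Serves to exchange the weight \<open>h x ^ (DIM('a) + 2)\<close> for the one at
  \<open>y\<close>, at the price of a power of the ratio of the two values of
  \<open>h\<close>.\<close>

lemma divide_power_le_divide_power:
  fixes a b c q :: real
  assumes "0 < a" "0 < b" "b \<le> c * a" "0 \<le> q"
  shows "q / a ^ n \<le> c ^ n * (q / b ^ n)"
proof -
  have "b ^ n \<le> c ^ n * a ^ n"
    using power_mono[OF assms(3), of n] assms(2) by (simp add: power_mult_distrib)
  then have "q * b ^ n \<le> q * (c ^ n * a ^ n)"
    using assms(4) by (rule mult_left_mono)
  then show ?thesis using assms(1,2) by (simp add: field_simps)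
qed

text \<open>Collects the two halves of the midpoint splitting into one constant: \<open>p\<close> is
  the Jacobian of the substitution, \<open>q\<close> the price of exchanging the weights.\<close>

lemma ennreal_weighted_sum:
  fixes p q :: real and e :: ennreal
  assumes "0 \<le> p" "0 \<le> q"
  shows "2 * (ennreal p * e) + ennreal (2 * q) * (ennreal p * e) = ennreal (2 * p * (1 + q)) * e"
proof -
  have "ennreal (2 * p * (1 + q)) = 2 * ennreal p + ennreal (2 * q) * ennreal p"
    using assms
    by (simp add: ennreal_mult[symmetric] ennreal_numeral[symmetric] algebra_simps
        del: ennreal_numeral flip: ennreal_plus)
  then show ?thesis by (simp add: distrib_right mult.assoc)
qed

text \<open>Isolates the properties of a localization function that drive the estimates: balls of
  radius \<open>h x\<close> stay in the domain, and on them \<open>h\<close> changes by at most a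
  third of the distance. Since \<delta> does not occur here, constants derived from these properties
  are uniform in \<delta>.\<close>

locale localized_domain =
  fixes \<Omega> :: "'a::euclidean_space set" and h :: "'a \<Rightarrow> real"
  assumes open_domain: "open \<Omega>"
    and bounded_domain: "bounded \<Omega>"
    and cont: "continuous_on \<Omega> h"
    and pos: "x \<in> \<Omega> \<Longrightarrow> 0 < h x"
    and mem: "x \<in> \<Omega> \<Longrightarrow> norm (y - x) \<le> h x \<Longrightarrow> y \<in> \<Omega>"
    and lipschitz: "x \<in> \<Omega> \<Longrightarrow> norm (y - x) \<le> h x \<Longrightarrow> \<bar>h y - h x\<bar> \<le> norm (y - x) / 3"
begin

section \<open>The seminorm as a Borel double integral, and the midpoint estimate\<close>

lemma lmeasurable_domain: "\<Omega> \<in> lmeasurable"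
  by (simp add: bounded_domain lmeasurable_open open_domain)

text \<open>Moves the restriction of \<open>y\<close> from the measure into the integrand, so that
  the inner measure no longer depends on \<open>x\<close> and Tonelli becomes applicable.\<close>

lemma W_seminorm_sq_restricted:
  "W_seminorm_sq \<Omega> s h u =
    (\<integral>\<^sup>+x. \<integral>\<^sup>+y. ennreal ((u x - u y)\<^sup>2 / h x ^ (DIM('a) + 2)) * indicator {y. norm (y - x) \<le> s * h x} y
       \<partial>lebesgue_on \<Omega> \<partial>lebesgue_on \<Omega>)"
proof -
  have O: "\<Omega> \<in> sets lebesgue" using lmeasurable_domain by auto
  have S: "{y. norm (y - x) \<le> s * h x} \<in> sets lebesgue" for x
  proof -
    have "{y. norm (y - x) \<le> s * h x} = cball x (s * h x)"
      by (auto simp: dist_norm norm_minus_commute)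
    then show ?thesis by simp
  qed
  show ?thesis
    unfolding W_seminorm_sq_def
    by (simp add: nn_integral_restrict_space O S sets.Int indicator_inter_arith mult_ac
        cong: nn_integral_cong)
qed

text \<open>
  The factor \<open>indicator \<Omega> x\<close> makes the integrand Borel measurable on the whole product space without
  any assumption on \<open>h\<close> outside \<open>\<Omega>\<close>.
\<close>

definition pair_energy :: "real \<Rightarrow> ('a \<Rightarrow> real) \<Rightarrow> 'a \<Rightarrow> 'a \<Rightarrow> ennreal" where
  "pair_energy s u x y =
     (if x \<in> \<Omega> \<and> y \<in> \<Omega> \<and> norm (y - x) \<le> s * (indicator \<Omega> x *\<^sub>R h x)
      then ennreal ((u x - u y)\<^sup>2 / (indicator \<Omega> x *\<^sub>R h x) ^ (DIM('a) + 2)) else 0)"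

lemma pair_energy_measurable [measurable]:
  assumes [measurable]: "u \<in> borel_measurable borel"
  shows "case_prod (pair_energy s u) \<in> borel_measurable (borel \<Otimes>\<^sub>M borel)"
proof -
  have [measurable]: "(\<lambda>x. indicator \<Omega> x *\<^sub>R h x) \<in> borel_measurable borel"
    by (intro borel_measurable_continuous_on_indicator cont borel_open open_domain)
  have [measurable]: "\<Omega> \<in> sets borel" by (simp add: open_domain)
  show ?thesis unfolding pair_energy_def by measurable
qed

lemma W_seminorm_sq_pair_energy:
  "W_seminorm_sq \<Omega> s h u = (\<integral>\<^sup>+x. \<integral>\<^sup>+y. pair_energy s u x y \<partial>lborel \<partial>lborel)"
proof -
  have O: "\<Omega> \<in> sets lebesgue" using lmeasurable_domain by auto
  show ?thesis
    unfolding W_seminorm_sq_restricted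
    by (auto simp: nn_integral_restrict_space O nn_integral_completion pair_energy_def indicator_def
        mult.commute simp flip: nn_integral_multc intro!: nn_integral_cong)
qed

lemma pair_energy_midpoint:
  assumes "0 < s" "s \<le> 1"
  shows "pair_energy s u x y \<le>
    2 * pair_energy (3/4 * s) u x ((1/2) *\<^sub>R (x + y)) +
    ennreal (2 * (4/3) ^ (DIM('a) + 2)) * pair_energy (3/4 * s) u y ((1/2) *\<^sub>R (x + y))"
proof (cases "x \<in> \<Omega> \<and> y \<in> \<Omega> \<and> norm (y - x) \<le> s * h x")
  case False
  then show ?thesis by (auto simp: pair_energy_def)
next
  case True
  then have x: "x \<in> \<Omega>" and y: "y \<in> \<Omega>" and le: "norm (y - x) \<le> s * h x" by auto
  define m where "m = (1/2) *\<^sub>R (x + y)"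
  have hx: "0 < h x" and hy: "0 < h y" using pos x y by auto
  have sh: "s * h x \<le> h x" using assms hx by simp
  have mx: "norm (m - x) = norm (y - x) / 2"
  proof -
    have "m - x = (1/2) *\<^sub>R (y - x)" by (simp add: m_def algebra_simps flip: scaleR_left.add)
    then show ?thesis by simp
  qed
  have my: "norm (m - y) = norm (y - x) / 2"
  proof -
    have "m - y = (1/2) *\<^sub>R (x - y)" by (simp add: m_def algebra_simps flip: scaleR_left.add)
    then show ?thesis by (simp add: norm_minus_commute)
  qed
  \<comment> \<open>The midpoint lies within \<open>h x / 2\<close> of \<open>x\<close>, hence in
    the domain; here \<open>s \<le> 1\<close> enters.\<close>
  have m: "m \<in> \<Omega>" using mem[OF x, of m] mx le sh norm_ge_zero[of "y - x"] by linarith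
  have l: "\<bar>h y - h x\<bar> \<le> norm (y - x) / 3" using lipschitz[OF x, of y] le sh by linarith
  have hxy: "2/3 * h x \<le> h y" and hyx: "h y \<le> 4/3 * h x" using l le sh by linarith+
  \<comment> \<open>Half the distance is at most \<open>s * h x / 2\<close>, and \<open>h x\<close>
    is at most 3/2 times \<open>h y\<close>; the product of 1/2 and 3/2 is the contraction factor
    3/4.\<close>
  have "2/3 * (s * h x) \<le> s * h y" using mult_left_mono[OF hxy, of s] assms by simp
  then have my_le: "norm (m - y) \<le> 3/4 * s * h y" using my le by linarith
  have "0 \<le> s * h x" using assms hx by simp
  then have mx_le: "norm (m - x) \<le> 3/4 * s * h x" using mx le by linarith
  have "(u x - u y)\<^sup>2 / h x ^ (DIM('a) + 2) \<le>
     2 * ((u x - u m)\<^sup>2 / h x ^ (DIM('a) + 2)) + 2 * ((u y - u m)\<^sup>2 / h x ^ (DIM('a) + 2))"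
    using midpoint_square_le[of "u x" "u y" "u m"] hx
    by (simp add: divide_simps power2_commute)
  \<comment> \<open>The second half is to be an energy centred at \<open>y\<close>, so its weight is
    exchanged using \<open>h y \<le> 4/3 * h x\<close>.\<close>
  moreover have "(u y - u m)\<^sup>2 / h x ^ (DIM('a) + 2) \<le> (4/3) ^ (DIM('a) + 2) * ((u y - u m)\<^sup>2 / h y ^ (DIM('a) + 2))"
    using hx hy hyx by (intro divide_power_le_divide_power) auto
  ultimately have "(u x - u y)\<^sup>2 / h x ^ (DIM('a) + 2) \<le>
     2 * ((u x - u m)\<^sup>2 / h x ^ (DIM('a) + 2)) +
     (2 * (4/3) ^ (DIM('a) + 2)) * ((u y - u m)\<^sup>2 / h y ^ (DIM('a) + 2))"
    by linarith
  then have "ennreal ((u x - u y)\<^sup>2 / h x ^ (DIM('a) + 2)) \<le>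
     ennreal (2 * ((u x - u m)\<^sup>2 / h x ^ (DIM('a) + 2)) +
     (2 * (4/3) ^ (DIM('a) + 2)) * ((u y - u m)\<^sup>2 / h y ^ (DIM('a) + 2)))"
    by (rule ennreal_leI)
  also have "\<dots> = 2 * ennreal ((u x - u m)\<^sup>2 / h x ^ (DIM('a) + 2)) +
      ennreal (2 * (4/3) ^ (DIM('a) + 2)) * ennreal ((u y - u m)\<^sup>2 / h y ^ (DIM('a) + 2))"
    using hx hy by (simp only: ennreal_plus ennreal_mult' mult_nonneg_nonneg divide_nonneg_nonneg
      zero_le_power2 zero_le_power less_imp_le zero_le_numeral ennreal_numeral)
  finally show ?thesis
    using x y m le mx_le my_le by (simp add: pair_energy_def flip: m_def)
qed

lemma nn_integral_midpoint:
  fixes f :: "'a \<Rightarrow> 'a \<Rightarrow> ennreal"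
  assumes [measurable]: "case_prod f \<in> borel_measurable (borel \<Otimes>\<^sub>M borel)"
  shows "(\<integral>\<^sup>+y. f x ((1/2) *\<^sub>R (x + y)) \<partial>lborel) = ennreal (2 ^ DIM('a)) * (\<integral>\<^sup>+m. f x m \<partial>lborel)"
  \<comment> \<open>This is the substitution \<open>y = 2 m - x\<close>: shift \<open>- x\<close>,
    factor 2, hence Jacobian \<open>2 ^ DIM('a)\<close>.\<close>
  by (subst nn_integral_lborel_affine[of _ 2 "- x"]) simp_all

lemma W_seminorm_sq_contract_borel:
  assumes [measurable]: "u \<in> borel_measurable borel" and s: "0 < s" "s \<le> 1"
  shows "W_seminorm_sq \<Omega> s h u \<le>
    ennreal (2 * 2 ^ DIM('a) * (1 + (4/3) ^ (DIM('a) + 2))) * W_seminorm_sq \<Omega> (3/4 * s) h u"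
proof -
  let ?P = "pair_energy (3/4 * s) u" and ?E = "W_seminorm_sq \<Omega> (3/4 * s) h u"
  let ?c = "ennreal (2 * (4/3) ^ (DIM('a) + 2))"
  have [measurable]: "case_prod ?P \<in> borel_measurable (borel \<Otimes>\<^sub>M borel)" by simp
  have "W_seminorm_sq \<Omega> s h u \<le>
     (\<integral>\<^sup>+x. \<integral>\<^sup>+y. 2 * ?P x ((1/2) *\<^sub>R (x + y)) + ?c * ?P y ((1/2) *\<^sub>R (x + y)) \<partial>lborel \<partial>lborel)"
    unfolding W_seminorm_sq_pair_energy by (intro nn_integral_mono pair_energy_midpoint s)
  also have "\<dots> = 2 * (\<integral>\<^sup>+x. \<integral>\<^sup>+y. ?P x ((1/2) *\<^sub>R (x + y)) \<partial>lborel \<partial>lborel) +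
      ?c * (\<integral>\<^sup>+x. \<integral>\<^sup>+y. ?P y ((1/2) *\<^sub>R (x + y)) \<partial>lborel \<partial>lborel)"
    by (simp add: nn_integral_add nn_integral_cmult)
  \<comment> \<open>After Tonelli this is the first double integral with the variables renamed, so
    the next equation evaluates both at once.\<close>
  also have "(\<integral>\<^sup>+x. \<integral>\<^sup>+y. ?P y ((1/2) *\<^sub>R (x + y)) \<partial>lborel \<partial>lborel) =
      (\<integral>\<^sup>+y. \<integral>\<^sup>+x. ?P y ((1/2) *\<^sub>R (y + x)) \<partial>lborel \<partial>lborel)"
    by (subst lborel_pair.Fubini') (simp_all add: add.commute)
  also have "(\<integral>\<^sup>+x. \<integral>\<^sup>+y. ?P x ((1/2) *\<^sub>R (x + y)) \<partial>lborel \<partial>lborel) = ennreal (2 ^ DIM('a)) * ?E"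
    by (simp add: nn_integral_midpoint nn_integral_cmult W_seminorm_sq_pair_energy)
  also have "2 * (ennreal (2 ^ DIM('a)) * ?E) + ?c * (ennreal (2 ^ DIM('a)) * ?E) =
    ennreal (2 * 2 ^ DIM('a) * (1 + (4/3) ^ (DIM('a) + 2))) * ?E"
    by (rule ennreal_weighted_sum) simp_all
  finally show ?thesis .
qed

section \<open>Change of representative and iteration of the contraction\<close>

lemma W_seminorm_sq_mono:
  assumes "s \<le> t"
  shows "W_seminorm_sq \<Omega> s h u \<le> W_seminorm_sq \<Omega> t h u"
  unfolding W_seminorm_sq_restricted
proof (intro nn_integral_mono mult_left_mono)
  fix x y assume "x \<in> space (lebesgue_on \<Omega>)"
  then have "s * h x \<le> t * h x"
    using assms pos[of x] by (intro mult_right_mono) auto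
  then show "indicator {y. norm (y - x) \<le> s * h x} y \<le> (indicator {y. norm (y - x) \<le> t * h x} y :: ennreal)"
    by (auto simp: indicator_def)
qed simp

text \<open>Argues section by section, first for almost every \<open>x\<close> and then for almost
  every \<open>y\<close>, so no measurability on the product is involved.\<close>

lemma W_seminorm_sq_cong_AE:
  assumes "AE x in lebesgue_on \<Omega>. u x = v x"
  shows "W_seminorm_sq \<Omega> s h u = W_seminorm_sq \<Omega> s h v"
  unfolding W_seminorm_sq_restricted
proof (rule nn_integral_cong_AE, use assms in eventually_elim)
  case (elim x)
  show ?case
    by (rule nn_integral_cong_AE, use assms in eventually_elim) (simp add: elim)
qed

text \<open>
  The midpoint substitution needs Borel functions: composing a merely Lebesgue measurable \<open>u\<close> with
  \<open>(x, y) \<mapsto> (x + y) / 2\<close> need not be measurable for the product of the Lebesgue \<open>\<sigma>\<close>-algebras.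
\<close>

lemma ex_borel_representative:
  fixes u :: "'a \<Rightarrow> real"
  assumes "u \<in> borel_measurable (lebesgue_on \<Omega>)"
  shows "\<exists>g\<in>borel_measurable borel. AE x in lebesgue_on \<Omega>. u x = g x"
proof -
  have O: "\<Omega> \<in> sets lebesgue" using lmeasurable_domain by auto
  have "(\<lambda>x. indicator \<Omega> x *\<^sub>R u x) \<in> borel_measurable lebesgue"
    using assms O by (subst (asm) borel_measurable_restrict_space_iff) auto
  then obtain g where g: "g \<in> borel_measurable lborel" "AE x in lborel. indicator \<Omega> x *\<^sub>R u x = g x"
    using completion_ex_borel_measurable_real by blast
  have "AE x in lebesgue_on \<Omega>. u x = g x"
    using g(2) O by (auto simp: AE_restrict_space_iff AE_completion_iff elim!: eventually_mono)
  then show ?thesis using g(1) by auto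
qed

lemma W_seminorm_sq_contract:
  assumes "u \<in> borel_measurable (lebesgue_on \<Omega>)" and "0 < s" "s \<le> 1"
  shows "W_seminorm_sq \<Omega> s h u \<le>
    ennreal (2 * 2 ^ DIM('a) * (1 + (4/3) ^ (DIM('a) + 2))) * W_seminorm_sq \<Omega> (3/4 * s) h u"
  using ex_borel_representative[OF assms(1)] W_seminorm_sq_contract_borel[OF _ assms(2,3)]
    W_seminorm_sq_cong_AE by metis

text \<open>Iterates the contraction from horizon 1, the largest it admits; each step multiplies the
  horizon by 3/4 and the constant by the same factor, which depends on the dimension alone.\<close>

lemma W_seminorm_sq_contract_power:
  assumes "u \<in> borel_measurable (lebesgue_on \<Omega>)"
  shows "W_seminorm_sq \<Omega> 1 h u \<le>
    ennreal ((2 * 2 ^ DIM('a) * (1 + (4/3) ^ (DIM('a) + 2))) ^ n) * W_seminorm_sq \<Omega> ((3/4) ^ n) h u"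
proof (induction n)
  case (Suc n)
  let ?K = "2 * 2 ^ DIM('a) * (1 + (4/3) ^ (DIM('a) + 2)) :: real"
  have "W_seminorm_sq \<Omega> 1 h u \<le> ennreal (?K ^ n) * W_seminorm_sq \<Omega> ((3/4) ^ n) h u"
    by (rule Suc)
  also have "\<dots> \<le> ennreal (?K ^ n) * (ennreal ?K * W_seminorm_sq \<Omega> (3/4 * (3/4) ^ n) h u)"
    by (intro mult_left_mono W_seminorm_sq_contract assms) (auto intro: power_le_one)
  also have "\<dots> = ennreal (?K ^ Suc n) * W_seminorm_sq \<Omega> ((3/4) ^ Suc n) h u"
  proof -
    have "ennreal (?K ^ n) * ennreal ?K = ennreal (?K ^ Suc n)"
      by (subst ennreal_mult[symmetric]) (simp_all only: power_Suc2, auto)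
    then show ?thesis by (simp only: mult.assoc[symmetric] power_Suc)
  qed
  finally show ?case .
qed simp

end

text \<open>The constant is quantified before the domain and \<open>h\<close>, so it depends on
  \<open>r\<close> and the dimension only; this is the source of uniformity in \<delta>. Enough
  contractions bring horizon 1 below \<open>r\<close>, and monotonicity in the horizon does the
  rest.\<close>

lemma W_seminorm_sq_horizon_comparison:
  assumes "0 < r"
  shows "\<exists>C>0. \<forall>(\<Omega> :: 'a::euclidean_space set) h u s. localized_domain \<Omega> h \<longrightarrow>
    u \<in> borel_measurable (lebesgue_on \<Omega>) \<longrightarrow> s \<le> 1 \<longrightarrow>
    W_seminorm_sq \<Omega> s h u \<le> ennreal C * W_seminorm_sq \<Omega> r h u"
proof -
  obtain n where n: "(3/4) ^ n < r"
    using real_arch_pow_inv[OF assms, of "3/4"] by auto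
  let ?K = "2 * 2 ^ DIM('a) * (1 + (4/3) ^ (DIM('a) + 2)) :: real"
  show ?thesis
  proof (intro exI[of _ "?K ^ n"] conjI allI impI)
    show "0 < ?K ^ n" by (intro zero_less_power mult_pos_pos add_pos_pos) auto
  next
    fix \<Omega> :: "'a set" and h u :: "'a \<Rightarrow> real" and s :: real
    assume "localized_domain \<Omega> h" and u: "u \<in> borel_measurable (lebesgue_on \<Omega>)" and s: "s \<le> 1"
    then interpret localized_domain \<Omega> h by simp
    have "W_seminorm_sq \<Omega> s h u \<le> W_seminorm_sq \<Omega> 1 h u" by (rule W_seminorm_sq_mono[OF s])
    also have "\<dots> \<le> ennreal (?K ^ n) * W_seminorm_sq \<Omega> ((3/4) ^ n) h u"
      by (rule W_seminorm_sq_contract_power[OF u])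
    also have "\<dots> \<le> ennreal (?K ^ n) * W_seminorm_sq \<Omega> r h u"
      by (intro mult_left_mono W_seminorm_sq_mono) (use n in auto)
    finally show "W_seminorm_sq \<Omega> s h u \<le> ennreal (?K ^ n) * W_seminorm_sq \<Omega> r h u" .
  qed
qed

subsection \<open>The nonlocal form\<close>

text \<open>Only the absolute value of the kernel is bounded and no sign is imposed:
  \<open>derived_kernel \<rho>\<close> may change sign, as an admissible kernel need not be
  monotone.\<close>

locale localized_kernel = localized_domain \<Omega> h
  for \<Omega> :: "'a::euclidean_space set" and h :: "'a \<Rightarrow> real" +
  fixes k :: "real \<Rightarrow> real" and K :: real
  assumes kernel_cont: "continuous_on {0..} k"
    and kernel_bound: "0 \<le> r \<Longrightarrow> \<bar>k r\<bar> \<le> K"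
    and kernel_support: "1 \<le> r \<Longrightarrow> k r = 0"

text \<open>A bounded open set has finite Lebesgue measure, which makes Fubini and Tonelli available
  on the product.\<close>

sublocale localized_domain \<subseteq> domain_pair: pair_sigma_finite "lebesgue_on \<Omega>" "lebesgue_on \<Omega>"
proof -
  interpret finite_measure "lebesgue_on \<Omega>"
    by (rule finite_measure_lebesgue_on) (rule lmeasurable_domain)
  show "pair_sigma_finite (lebesgue_on \<Omega>) (lebesgue_on \<Omega>)" ..
qed

context localized_domain
begin

section \<open>Measurability and Tonelli for the Lebesgue product\<close>

lemma h_measurable [measurable]: "h \<in> borel_measurable (lebesgue_on \<Omega>)"
  using continuous_imp_measurable_on_sets_lebesgue[OF cont] lmeasurable_domain by auto

lemma ident_measurable [measurable]: "(\<lambda>x. x) \<in> borel_measurable (lebesgue_on \<Omega>)"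
  using id_borel_measurable_lebesgue_on[of \<Omega>] by (simp add: id_def)

text \<open>The counterpart of \<open>pair_energy\<close> on the square of
  \<open>lebesgue_on \<Omega>\<close>, the measure in which \<open>form_converges\<close> is
  phrased; it admits Lebesgue measurable \<open>u\<close>.\<close>

definition horizon_density :: "real \<Rightarrow> ('a \<Rightarrow> real) \<Rightarrow> 'a \<Rightarrow> 'a \<Rightarrow> ennreal" where
  "horizon_density s u x y =
     ennreal ((u x - u y)\<^sup>2 / h x ^ (DIM('a) + 2)) * indicator {y. norm (y - x) \<le> s * h x} y"

lemma horizon_density_measurable [measurable]:
  assumes [measurable]: "u \<in> borel_measurable (lebesgue_on \<Omega>)"
  shows "case_prod (horizon_density s u) \<in> borel_measurable (lebesgue_on \<Omega> \<Otimes>\<^sub>M lebesgue_on \<Omega>)"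
  unfolding horizon_density_def indicator_def mem_Collect_eq by measurable

text \<open>The second identity integrates in the opposite order; it serves the half of the
  symmetrized kernel that is scaled by \<open>h y\<close>.\<close>

lemma nn_integral_horizon_density:
  assumes [measurable]: "u \<in> borel_measurable (lebesgue_on \<Omega>)"
  shows "(\<integral>\<^sup>+(x, y). horizon_density s u x y \<partial>(lebesgue_on \<Omega> \<Otimes>\<^sub>M lebesgue_on \<Omega>)) = W_seminorm_sq \<Omega> s h u"
    and "(\<integral>\<^sup>+(x, y). horizon_density s u y x \<partial>(lebesgue_on \<Omega> \<Otimes>\<^sub>M lebesgue_on \<Omega>)) = W_seminorm_sq \<Omega> s h u"
proof -
  show "(\<integral>\<^sup>+(x, y). horizon_density s u x y \<partial>(lebesgue_on \<Omega> \<Otimes>\<^sub>M lebesgue_on \<Omega>)) = W_seminorm_sq \<Omega> s h u"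
    by (subst domain_pair.M1.nn_integral_fst[symmetric])
       (simp_all add: W_seminorm_sq_restricted horizon_density_def)
  show "(\<integral>\<^sup>+(x, y). horizon_density s u y x \<partial>(lebesgue_on \<Omega> \<Otimes>\<^sub>M lebesgue_on \<Omega>)) = W_seminorm_sq \<Omega> s h u"
    by (subst domain_pair.nn_integral_snd[symmetric])
       (simp_all add: W_seminorm_sq_restricted horizon_density_def)
qed

end

context localized_kernel
begin

section \<open>Bounds for the form by seminorms\<close>

lemma scaled_kernel_measurable [measurable]:
  "case_prod (scaled_kernel k h \<alpha>) \<in> borel_measurable (lebesgue_on \<Omega> \<Otimes>\<^sub>M lebesgue_on \<Omega>)"
proof -
  \<comment> \<open>The kernel is continuous on the half-line only. Extending it constantly to
    negative arguments gives a Borel function, and on the domain all arguments are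
    nonnegative.\<close>
  have "continuous_on UNIV (\<lambda>r. k (max 0 r))"
    by (rule continuous_on_compose2[OF kernel_cont]) (auto intro!: continuous_intros)
  then have [measurable]: "(\<lambda>r. k (max 0 r)) \<in> borel_measurable borel"
    by (rule borel_measurable_continuous_onI)
  have "case_prod (scaled_kernel (\<lambda>r. k (max 0 r)) h \<alpha>) \<in> borel_measurable (lebesgue_on \<Omega> \<Otimes>\<^sub>M lebesgue_on \<Omega>)"
    unfolding scaled_kernel_def by measurable
  then show ?thesis
    by (rule measurable_cong[THEN iffD1, rotated])
       (auto simp: space_pair_measure scaled_kernel_def max_def pos less_imp_le dest: pos split: if_splits)
qed

lemma form_integrand_measurable [measurable]:
  assumes [measurable]: "u \<in> borel_measurable (lebesgue_on \<Omega>)" "v \<in> borel_measurable (lebesgue_on \<Omega>)"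
  shows "case_prod (form_integrand k h u v) \<in> borel_measurable (lebesgue_on \<Omega> \<Otimes>\<^sub>M lebesgue_on \<Omega>)"
  unfolding form_integrand_def by measurable

lemma kernel_bound_nonneg: "0 \<le> K"
  using kernel_bound[of 0] by linarith

text \<open>The kernel is at most \<open>K\<close> in absolute value and vanishes once its argument
  reaches 1, which produces the indicator of horizon 1.\<close>

lemma kernel_term_le:
  assumes x: "x \<in> \<Omega>"
  shows "\<bar>1 / h x powr (real DIM('a) + 2) * k (norm (y - x) / h x)\<bar> * q
    \<le> K * (\<bar>q\<bar> / h x ^ (DIM('a) + 2) * indicator {y. norm (y - x) \<le> 1 * h x} y)"
proof (cases "norm (y - x) \<le> h x")
  case True
  have hx: "0 < h x" using pos x .
  have p: "h x powr (real DIM('a) + 2) = h x ^ (DIM('a) + 2)"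
    using powr_realpow[OF hx, of "DIM('a) + 2"] by (simp add: add.commute)
  have "\<bar>k (norm (y - x) / h x)\<bar> * q \<le> K * \<bar>q\<bar>"
    using kernel_bound[of "norm (y - x) / h x"] hx kernel_bound_nonneg
    by (intro order_trans[OF mult_left_mono mult_right_mono]) auto
  then have "\<bar>k (norm (y - x) / h x)\<bar> * q / h x ^ (DIM('a) + 2) \<le> K * \<bar>q\<bar> / h x ^ (DIM('a) + 2)"
    using hx by (intro divide_right_mono) auto
  then show ?thesis
    using True hx by (simp only: p) (simp add: abs_mult)
next
  case False
  then have "k (norm (y - x) / h x) = 0"
    using pos[OF x] by (intro kernel_support) (simp add: field_simps)
  with False show ?thesis by simp
qed

text \<open>Each half of the symmetrized kernel contributes \<open>K / 2\<close> times the seminorm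
  with horizon 1, the second one after exchanging the variables.\<close>

lemma energy_le:
  assumes [measurable]: "u \<in> borel_measurable (lebesgue_on \<Omega>)"
  shows "(\<integral>\<^sup>+(x, y). ennreal (\<bar>scaled_kernel k h 2 x y\<bar> * (u x - u y)\<^sup>2) \<partial>(lebesgue_on \<Omega> \<Otimes>\<^sub>M lebesgue_on \<Omega>))
    \<le> ennreal K * W_seminorm_sq \<Omega> 1 h u"
proof -
  have "(\<integral>\<^sup>+(x, y). ennreal (\<bar>scaled_kernel k h 2 x y\<bar> * (u x - u y)\<^sup>2) \<partial>(lebesgue_on \<Omega> \<Otimes>\<^sub>M lebesgue_on \<Omega>))
    \<le> (\<integral>\<^sup>+(x, y). ennreal (K / 2) * (horizon_density 1 u x y + horizon_density 1 u y x) \<partial>(lebesgue_on \<Omega> \<Otimes>\<^sub>M lebesgue_on \<Omega>))"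
  proof (rule nn_integral_mono, clarify)
    fix x y assume "(x, y) \<in> space (lebesgue_on \<Omega> \<Otimes>\<^sub>M lebesgue_on \<Omega>)"
    then have xy: "x \<in> \<Omega>" "y \<in> \<Omega>" by (auto simp: space_pair_measure)
    define q where "q = (u x - u y)\<^sup>2"
    define a where "a = 1 / h x powr (real DIM('a) + 2) * k (norm (y - x) / h x)"
    define b where "b = 1 / h y powr (real DIM('a) + 2) * k (norm (x - y) / h y)"
    define a' where "a' = q / h x ^ (DIM('a) + 2) * indicator {y. norm (y - x) \<le> 1 * h x} y"
    define b' where "b' = q / h y ^ (DIM('a) + 2) * indicator {x. norm (x - y) \<le> 1 * h y} x"
    have nn: "0 \<le> q" "0 \<le> a'" "0 \<le> b'"
      using pos xy by (auto simp: q_def a'_def b'_def less_imp_le)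
    have "\<bar>a\<bar> * q \<le> K * a'" "\<bar>b\<bar> * q \<le> K * b'"
      using kernel_term_le[OF xy(1), of y q] kernel_term_le[OF xy(2), of x q] nn(1)
      by (auto simp: a_def b_def a'_def b'_def)
    moreover have "\<bar>1 / 2 * (a + b)\<bar> * q \<le> (\<bar>a\<bar> / 2 + \<bar>b\<bar> / 2) * q"
      using nn by (intro mult_right_mono) auto
    ultimately have "\<bar>1 / 2 * (a + b)\<bar> * q \<le> K / 2 * (a' + b')"
      by (simp add: algebra_simps)
    moreover have "scaled_kernel k h 2 x y = 1 / 2 * (a + b)"
      by (simp add: scaled_kernel_def a_def b_def norm_minus_commute)
    ultimately have "ennreal (\<bar>scaled_kernel k h 2 x y\<bar> * q) \<le> ennreal (K / 2 * (a' + b'))"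
      by (simp only: ennreal_leI)
    also have "\<dots> = ennreal (K / 2) * (ennreal a' + ennreal b')"
      using nn kernel_bound_nonneg
      by (simp only: ennreal_mult ennreal_plus add_nonneg_nonneg divide_nonneg_nonneg zero_le_numeral)
    also have "ennreal a' = horizon_density 1 u x y"
      by (simp add: a'_def horizon_density_def q_def indicator_def)
    also have "ennreal b' = horizon_density 1 u y x"
      by (simp add: b'_def horizon_density_def q_def indicator_def power2_commute)
    finally show "ennreal (\<bar>scaled_kernel k h 2 x y\<bar> * (u x - u y)\<^sup>2)
      \<le> ennreal (K / 2) * (horizon_density 1 u x y + horizon_density 1 u y x)"
      by (simp add: q_def)
  qed
  also have "\<dots> = ennreal (K / 2) *
     ((\<integral>\<^sup>+(x, y). horizon_density 1 u x y \<partial>(lebesgue_on \<Omega> \<Otimes>\<^sub>M lebesgue_on \<Omega>)) +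
      (\<integral>\<^sup>+(x, y). horizon_density 1 u y x \<partial>(lebesgue_on \<Omega> \<Otimes>\<^sub>M lebesgue_on \<Omega>)))"
    by (simp add: case_prod_unfold nn_integral_cmult nn_integral_add)
  also have "\<dots> = ennreal K * W_seminorm_sq \<Omega> 1 h u"
    using kernel_bound_nonneg
    by (simp add: nn_integral_horizon_density distrib_left flip: distrib_right ennreal_plus)
  finally show ?thesis .
qed

text \<open>The half scaled by \<open>h y\<close> is nonnegative and is dropped; the half scaled by
  \<open>h x\<close> is at least \<open>c\<close> within horizon \<open>r\<^sub>0\<close>. The
  symmetrization accounts for \<open>c / 2\<close>.\<close>

lemma le_energy:
  assumes [measurable]: "u \<in> borel_measurable (lebesgue_on \<Omega>)"
    and nonneg: "\<And>r. 0 \<le> r \<Longrightarrow> 0 \<le> k r" and low: "\<And>r. 0 \<le> r \<Longrightarrow> r \<le> r\<^sub>0 \<Longrightarrow> c \<le> k r" and "0 \<le> c"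
  shows "ennreal (c / 2) * W_seminorm_sq \<Omega> r\<^sub>0 h u \<le>
    (\<integral>\<^sup>+(x, y). ennreal (scaled_kernel k h 2 x y * (u x - u y)\<^sup>2) \<partial>(lebesgue_on \<Omega> \<Otimes>\<^sub>M lebesgue_on \<Omega>))"
proof -
  have "ennreal (c / 2) * W_seminorm_sq \<Omega> r\<^sub>0 h u =
    (\<integral>\<^sup>+(x, y). ennreal (c / 2) * horizon_density r\<^sub>0 u x y \<partial>(lebesgue_on \<Omega> \<Otimes>\<^sub>M lebesgue_on \<Omega>))"
    unfolding nn_integral_horizon_density(1)[OF assms(1), symmetric] case_prod_unfold
    by (rule nn_integral_cmult[symmetric]) measurable
  also have "\<dots> \<le>
    (\<integral>\<^sup>+(x, y). ennreal (scaled_kernel k h 2 x y * (u x - u y)\<^sup>2) \<partial>(lebesgue_on \<Omega> \<Otimes>\<^sub>M lebesgue_on \<Omega>))"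
  proof (rule nn_integral_mono, clarify)
    fix x y assume "(x, y) \<in> space (lebesgue_on \<Omega> \<Otimes>\<^sub>M lebesgue_on \<Omega>)"
    then have hx: "0 < h x" and hy: "0 < h y" using pos by (auto simp: space_pair_measure)
    have p: "h x powr (real DIM('a) + 2) = h x ^ (DIM('a) + 2)"
      using powr_realpow[OF hx, of "DIM('a) + 2"] by (simp add: add.commute)
    define i where "i = (indicator {y. norm (y - x) \<le> r\<^sub>0 * h x} y :: real)"
    have "c * i \<le> k (norm (y - x) / h x)"
      using nonneg[of "norm (y - x) / h x"] low[of "norm (y - x) / h x"] hx
      by (auto simp: i_def indicator_def field_simps)
    then have "c * i / h x ^ (DIM('a) + 2) \<le> k (norm (y - x) / h x) / h x ^ (DIM('a) + 2)"
      using hx by (intro divide_right_mono) auto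
    moreover have "0 \<le> 1 / h y powr (real DIM('a) + 2) * k (norm (y - x) / h y)"
      using nonneg[of "norm (y - x) / h y"] hy by simp
    ultimately have "c / 2 * (i / h x ^ (DIM('a) + 2)) \<le> scaled_kernel k h 2 x y"
      unfolding scaled_kernel_def p by simp
    from mult_right_mono[OF this, of "(u x - u y)\<^sup>2"]
    have "c / 2 * ((u x - u y)\<^sup>2 / h x ^ (DIM('a) + 2) * i) \<le> scaled_kernel k h 2 x y * (u x - u y)\<^sup>2"
      by (simp add: mult_ac)
    then have "ennreal (c / 2 * ((u x - u y)\<^sup>2 / h x ^ (DIM('a) + 2) * i)) \<le>
        ennreal (scaled_kernel k h 2 x y * (u x - u y)\<^sup>2)"
      by (rule ennreal_leI)
    also have "ennreal (c / 2 * ((u x - u y)\<^sup>2 / h x ^ (DIM('a) + 2) * i)) =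
        ennreal (c / 2) * horizon_density r\<^sub>0 u x y"
      using \<open>0 \<le> c\<close> hx by (subst ennreal_mult') (auto simp: horizon_density_def i_def indicator_def)
    finally show "ennreal (c / 2) * horizon_density r\<^sub>0 u x y \<le>
        ennreal (scaled_kernel k h 2 x y * (u x - u y)\<^sup>2)" .
  qed
  finally show ?thesis .
qed

text \<open>Cauchy-Schwarz after distributing a square root of the absolute kernel to each
  difference. In extended nonnegative reals it needs no prior finiteness, so it can be used to prove
  integrability.\<close>

lemma nn_integral_form_integrand_le:
  assumes [measurable]: "u \<in> borel_measurable (lebesgue_on \<Omega>)" "v \<in> borel_measurable (lebesgue_on \<Omega>)"
  shows "(\<integral>\<^sup>+(x, y). ennreal \<bar>form_integrand k h u v x y\<bar> \<partial>(lebesgue_on \<Omega> \<Otimes>\<^sub>M lebesgue_on \<Omega>))\<^sup>2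
    \<le> (ennreal K * W_seminorm_sq \<Omega> 1 h u) * (ennreal K * W_seminorm_sq \<Omega> 1 h v)"
proof -
  let ?M = "lebesgue_on \<Omega> \<Otimes>\<^sub>M lebesgue_on \<Omega>"
  define f where "f w z = ennreal (sqrt \<bar>scaled_kernel k h 2 (fst z) (snd z)\<bar> * \<bar>w (fst z) - w (snd z)\<bar>)"
    for w :: "'a \<Rightarrow> real" and z :: "'a \<times> 'a"
  have f [measurable]: "f w \<in> borel_measurable ?M"
    if [measurable]: "w \<in> borel_measurable (lebesgue_on \<Omega>)" for w
    unfolding f_def by measurable
  have "(\<integral>\<^sup>+(x, y). ennreal \<bar>form_integrand k h u v x y\<bar> \<partial>?M) = (\<integral>\<^sup>+z. f u z * f v z \<partial>?M)"
  proof (rule nn_integral_cong)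
    fix z
    have "sqrt \<bar>a\<bar> * b * (sqrt \<bar>a\<bar> * c) = \<bar>a\<bar> * b * c" for a b c :: real
      by (simp add: mult_ac flip: mult.assoc[of "sqrt \<bar>a\<bar>" "sqrt \<bar>a\<bar>"])
    then show "(case z of (x, y) \<Rightarrow> ennreal \<bar>form_integrand k h u v x y\<bar>) = f u z * f v z"
      by (simp add: f_def form_integrand_def abs_mult case_prod_unfold flip: ennreal_mult)
  qed
  also have "\<dots>\<^sup>2 \<le> (\<integral>\<^sup>+z. (f u z)\<^sup>2 \<partial>?M) * (\<integral>\<^sup>+z. (f v z)\<^sup>2 \<partial>?M)"
    by (rule Cauchy_Schwarz_nn_integral) measurable
  also have "\<dots> \<le> (ennreal K * W_seminorm_sq \<Omega> 1 h u) * (ennreal K * W_seminorm_sq \<Omega> 1 h v)"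
  proof -
    have "(\<integral>\<^sup>+z. (f w z)\<^sup>2 \<partial>?M) \<le> ennreal K * W_seminorm_sq \<Omega> 1 h w"
      if "w \<in> borel_measurable (lebesgue_on \<Omega>)" for w
      using energy_le[OF that]
      by (simp add: f_def case_prod_unfold ennreal_power power_mult_distrib)
    then show ?thesis by (intro mult_mono assms) simp_all
  qed
  finally show ?thesis .
qed

lemma
  assumes [measurable]: "u \<in> borel_measurable (lebesgue_on \<Omega>)" "v \<in> borel_measurable (lebesgue_on \<Omega>)"
    and fin: "W_seminorm_sq \<Omega> 1 h u < \<infinity>" "W_seminorm_sq \<Omega> 1 h v < \<infinity>"
  shows form_converges_finite: "form_converges \<Omega> k h u v"
    and nonlocal_form_le: "nonlocal_form \<Omega> k h u v \<le> K * W_seminorm \<Omega> 1 h u * W_seminorm \<Omega> 1 h v"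
proof -
  let ?M = "lebesgue_on \<Omega> \<Otimes>\<^sub>M lebesgue_on \<Omega>"
  let ?I = "\<integral>\<^sup>+(x, y). ennreal \<bar>form_integrand k h u v x y\<bar> \<partial>?M"
  let ?u = "enn2real (W_seminorm_sq \<Omega> 1 h u)" and ?v = "enn2real (W_seminorm_sq \<Omega> 1 h v)"
  have "?I\<^sup>2 \<le> (ennreal K * W_seminorm_sq \<Omega> 1 h u) * (ennreal K * W_seminorm_sq \<Omega> 1 h v)"
    by (rule nn_integral_form_integrand_le) fact+
  also have "\<dots> = ennreal ((K * ?u) * (K * ?v))"
    using fin kernel_bound_nonneg by (simp add: ennreal_mult less_top)
  finally have I2: "?I\<^sup>2 \<le> ennreal ((K * ?u) * (K * ?v))" .
  \<comment> \<open>Integrability comes first: it is what lets Fubini identify the iterated integral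
    with the product integral.\<close>
  have I: "?I < \<infinity>"
    using le_less_trans[OF I2 ennreal_less_top] by (simp add: power_less_top_ennreal)
  then have int: "integrable ?M (\<lambda>(x, y). form_integrand k h u v x y)"
    by (intro integrableI_bounded) (auto simp: case_prod_unfold)
  then show "form_converges \<Omega> k h u v" by (simp add: form_converges_def)
  have "nonlocal_form \<Omega> k h u v = (LINT (x, y)|?M. form_integrand k h u v x y)"
    using domain_pair.integral_fst'[OF int] by (simp add: nonlocal_form_def)
  also have "\<dots> \<le> (LINT (x, y)|?M. \<bar>form_integrand k h u v x y\<bar>)"
    using order_trans[OF abs_ge_self integral_abs_bound, of ?M "\<lambda>(x, y). form_integrand k h u v x y"] by (simp add: case_prod_unfold)
  also have "\<dots> = enn2real ?I"
    by (subst integral_eq_nn_integral) (auto simp: case_prod_unfold)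
  also have "\<dots> \<le> sqrt ((K * ?u) * (K * ?v))"
  proof (rule real_le_rsqrt)
    have "ennreal ((enn2real ?I)\<^sup>2) = ?I\<^sup>2"
      using I by (simp add: ennreal_power[symmetric])
    then have "ennreal ((enn2real ?I)\<^sup>2) \<le> ennreal ((K * ?u) * (K * ?v))"
      using I2 by (simp only:)
    then show "(enn2real ?I)\<^sup>2 \<le> (K * ?u) * (K * ?v)"
      using kernel_bound_nonneg by (subst (asm) ennreal_le_iff) simp_all
  qed
  also have "\<dots> = K * W_seminorm \<Omega> 1 h u * W_seminorm \<Omega> 1 h v"
    using kernel_bound_nonneg by (simp add: W_seminorm_def real_sqrt_mult mult_ac)
  finally show "nonlocal_form \<Omega> k h u v \<le> K * W_seminorm \<Omega> 1 h u * W_seminorm \<Omega> 1 h v" .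
qed

text \<open>Finiteness at horizon 1 makes the integrand integrable, so that the Bochner integral is
  the nonnegative integral bounded below by \<open>le_energy\<close> and not the default value
  0.\<close>

lemma W_seminorm_sq_le_nonlocal_form:
  assumes [measurable]: "u \<in> borel_measurable (lebesgue_on \<Omega>)"
    and fin: "W_seminorm_sq \<Omega> 1 h u < \<infinity>"
    and nonneg: "\<And>r. 0 \<le> r \<Longrightarrow> 0 \<le> k r" and low: "\<And>r. 0 \<le> r \<Longrightarrow> r \<le> r\<^sub>0 \<Longrightarrow> c \<le> k r" and "0 \<le> c"
  shows "0 \<le> nonlocal_form \<Omega> k h u u"
    and "ennreal (c / 2) * W_seminorm_sq \<Omega> r\<^sub>0 h u \<le> ennreal (nonlocal_form \<Omega> k h u u)"
proof -
  let ?M = "lebesgue_on \<Omega> \<Otimes>\<^sub>M lebesgue_on \<Omega>"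
  have int: "integrable ?M (\<lambda>(x, y). form_integrand k h u u x y)"
    using form_converges_finite[of u u] fin by (simp add: form_converges_def)
  have nn: "0 \<le> form_integrand k h u u (fst z) (snd z)" if "z \<in> space ?M" for z
  proof -
    have "fst z \<in> \<Omega>" "snd z \<in> \<Omega>" using that by (auto simp: space_pair_measure)
    then have "0 \<le> k (norm (snd z - fst z) / h (fst z))" "0 \<le> k (norm (snd z - fst z) / h (snd z))"
      by (auto intro!: nonneg divide_nonneg_nonneg less_imp_le[OF pos])
    then have "0 \<le> scaled_kernel k h 2 (fst z) (snd z)"
      by (simp add: scaled_kernel_def)
    then show ?thesis by (simp add: form_integrand_def mult.assoc)
  qed
  have "ennreal (c / 2) * W_seminorm_sq \<Omega> r\<^sub>0 h u \<le> (\<integral>\<^sup>+(x, y). ennreal (form_integrand k h u u x y) \<partial>?M)"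
    using le_energy[OF assms(1) nonneg low \<open>0 \<le> c\<close>]
    by (simp add: form_integrand_def power2_eq_square mult.assoc)
  also have "\<dots> = ennreal (LINT (x, y)|?M. form_integrand k h u u x y)"
    using nn_integral_eq_integral[OF int] nn by (simp add: case_prod_unfold AE_I2)
  also have eq: "(LINT (x, y)|?M. form_integrand k h u u x y) = nonlocal_form \<Omega> k h u u"
    using domain_pair.integral_fst'[OF int] by (simp add: nonlocal_form_def)
  finally show "ennreal (c / 2) * W_seminorm_sq \<Omega> r\<^sub>0 h u \<le> ennreal (nonlocal_form \<Omega> k h u u)" .
  show "0 \<le> nonlocal_form \<Omega> k h u u"
    unfolding eq[symmetric] using nn by (intro Bochner_Integration.integral_nonneg) (simp add: case_prod_unfold)
qed

end

subsection \<open>Localization functions and admissible kernels\<close>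

lemma C_k_on_differentiable:
  assumes "C_k_on (Suc k) U f" "x \<in> U"
  shows "f differentiable (at x)"
  using assms by (auto simp: C_k_on_def dest!: spec[of _ "[]"])

lemma frechet_derivative_eq_inner_grad:
  assumes "f differentiable (at x)"
  shows "frechet_derivative f (at x) v = grad f x \<bullet> v"
proof -
  interpret linear "frechet_derivative f (at x)"
    using assms by (rule linear_frechet_derivative)
  have "frechet_derivative f (at x) v = frechet_derivative f (at x) (\<Sum>b\<in>Basis. (v \<bullet> b) *\<^sub>R b)"
    by (simp add: euclidean_representation)
  also have "\<dots> = grad f x \<bullet> v"
    by (simp add: sum scale grad_def inner_sum_left inner_sum_right inner_commute mult.commute)
  finally show ?thesis .
qed

text \<open>The mean value inequality needs convexity, which the domain may lack; it is applied on
  the balls \<open>cball x (h x)\<close>.\<close>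

lemma grad_bound_imp_lipschitz:
  fixes f :: "'a::euclidean_space \<Rightarrow> real"
  assumes "convex S" and d: "\<And>z. z \<in> S \<Longrightarrow> f differentiable (at z)"
    and b: "\<And>z. z \<in> S \<Longrightarrow> norm (grad f z) \<le> B" and "x \<in> S" "y \<in> S"
  shows "\<bar>f y - f x\<bar> \<le> B * norm (y - x)"
proof -
  have "norm (f y - f x) \<le> B * norm (y - x)"
  proof (rule differentiable_bound[OF assms(1), of f "\<lambda>z. frechet_derivative f (at z)"])
    fix z assume z: "z \<in> S"
    show "(f has_derivative frechet_derivative f (at z)) (at z within S)"
      using d[OF z] frechet_derivative_works has_derivative_at_withinI by blast
    show "onorm (frechet_derivative f (at z)) \<le> B"
    proof (rule onorm_le)
      fix v
      have "norm (grad f z \<bullet> v) \<le> norm (grad f z) * norm v"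
        using Cauchy_Schwarz_ineq2[of "grad f z" v] by simp
      also have "\<dots> \<le> B * norm v" using b[OF z] by (rule mult_right_mono) simp
      finally show "norm (frechet_derivative f (at z) v) \<le> B * norm v"
        using frechet_derivative_eq_inner_grad[OF d[OF z]] by simp
    qed
  qed (use assms in auto)
  then show ?thesis by simp
qed

text \<open>A ball is connected, so if it met both the set and its complement it would contain a
  frontier point closer to the centre than the distance allows. For an empty frontier
  \<open>infdist\<close> is 0 and the ball is empty.\<close>

lemma ball_infdist_frontier_subset:
  fixes S :: "'a::euclidean_space set"
  assumes "x \<in> S"
  shows "ball x (infdist x (frontier S)) \<subseteq> S"
proof (rule ccontr)
  let ?B = "ball x (infdist x (frontier S))"
  assume n: "\<not> ?B \<subseteq> S"
  then have "x \<in> ?B" by (metis ball_eq_empty centre_in_ball empty_subsetI not_le)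
  with assms have "?B \<inter> S \<noteq> {}" by blast
  then have "?B \<inter> frontier S \<noteq> {}" using n by (intro connected_Int_frontier) auto
  then obtain z where "z \<in> frontier S" "dist x z < infdist x (frontier S)" by auto
  then show False using infdist_le[of z "frontier S" x] by simp
qed

text \<open>
  The two upper bounds on \<open>\<delta>\<close> in \<^const>\<open>delta0\<close> give respectively the Lipschitz constant \<open>1/3\<close> and
  \<open>\<eta>\<^sub>\<delta> \<le> dist(\<cdot>, \<partial>\<Omega>)\<close>, the latter because \<open>min {\<delta>, t\<^sup>2} \<le> t \<surd>\<delta>\<close>.
\<close>

lemma localization_functions_localized_domain:
  assumes dom: "bounded_C2_domain \<Omega>" and loc: "localization_functions \<Omega> \<kappa>\<^sub>0 \<kappa>\<^sub>1 \<kappa>\<^sub>2 \<kappa>\<^sub>b \<eta>"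
    and "0 < \<kappa>\<^sub>1" "0 < \<kappa>\<^sub>b" and d: "0 < \<delta>" "\<delta> < delta0 \<kappa>\<^sub>1 \<kappa>\<^sub>b"
  shows "localized_domain \<Omega> (\<eta> \<delta>)"
proof -
  let ?h = "\<eta> \<delta>" and ?d = "\<lambda>x. infdist x (frontier \<Omega>)"
  have d9: "\<delta> < 1 / (9 * \<kappa>\<^sub>1\<^sup>2)" and d2: "\<delta> < 1 / (2 * \<kappa>\<^sub>b\<^sup>2)"
    using d by (auto simp: delta0_def)
  have k1: "\<kappa>\<^sub>1 * sqrt \<delta> \<le> 1 / 3"
  proof (rule power2_le_imp_le)
    show "(\<kappa>\<^sub>1 * sqrt \<delta>)\<^sup>2 \<le> (1 / 3)\<^sup>2"
      using d d9 assms(3) by (simp add: power_mult_distrib field_simps power2_eq_square)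
  qed simp
  have kb: "\<kappa>\<^sub>b * sqrt \<delta> < 1"
  proof (rule power2_less_imp_less)
    show "(\<kappa>\<^sub>b * sqrt \<delta>)\<^sup>2 < 1\<^sup>2"
      using d d2 assms(4) by (simp add: power_mult_distrib field_simps)
  qed simp
  have C1: "C_k_on (Suc 1) \<Omega> ?h"
    and grad: "\<And>x. x \<in> \<Omega> \<Longrightarrow> norm (grad ?h x) \<le> \<kappa>\<^sub>1 * sqrt \<delta>"
    and pos: "\<And>x. x \<in> \<Omega> \<Longrightarrow> 0 < ?h x"
    and le: "\<And>x. x \<in> \<Omega> \<Longrightarrow> ?h x \<le> \<kappa>\<^sub>b * min \<delta> ((?d x)\<^sup>2)"
    using loc d by (auto simp: localization_functions_def C_k_closure_def numeral_2_eq_2)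
  have lt: "?h x < ?d x" if x: "x \<in> \<Omega>" for x
  proof -
    have dn: "0 \<le> ?d x" by (rule infdist_nonneg)
    have "min \<delta> ((?d x)\<^sup>2) \<le> sqrt \<delta> * ?d x"
    proof (cases "?d x \<le> sqrt \<delta>")
      case True
      then have "(?d x)\<^sup>2 \<le> sqrt \<delta> * ?d x"
        using dn by (simp add: power2_eq_square mult_right_mono)
      then show ?thesis by linarith
    next
      case False
      then have "sqrt \<delta> * sqrt \<delta> \<le> sqrt \<delta> * ?d x" using d by (intro mult_left_mono) auto
      then show ?thesis using d by simp
    qed
    then have "\<kappa>\<^sub>b * min \<delta> ((?d x)\<^sup>2) \<le> \<kappa>\<^sub>b * (sqrt \<delta> * ?d x)"
      using assms(4) by (intro mult_left_mono) auto
    with le[OF x] have *: "?h x \<le> (\<kappa>\<^sub>b * sqrt \<delta>) * ?d x" by (simp add: mult.assoc)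
    \<comment> \<open>If the distance were 0, the bound would force \<open>?h x \<le> 0\<close>;
      this also rules out the default value of \<open>infdist\<close> at an empty frontier.\<close>
    with pos[OF x] dn have "0 < ?d x" by (cases "?d x = 0") auto
    then have "(\<kappa>\<^sub>b * sqrt \<delta>) * ?d x < 1 * ?d x" using kb by (rule mult_strict_right_mono[rotated])
    with * show ?thesis by simp
  qed
  have cball: "cball x (?h x) \<subseteq> \<Omega>" if x: "x \<in> \<Omega>" for x
    using lt[OF x] ball_infdist_frontier_subset[OF x] by (force simp: subset_iff)
  show ?thesis
  proof
    show "open \<Omega>" "bounded \<Omega>" using dom by (auto simp: bounded_C2_domain_def)
    show "continuous_on \<Omega> ?h" using C_k_on_differentiable[OF C1]
      by (meson continuous_at_imp_continuous_on differentiable_imp_continuous_within)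
    fix x y assume x: "x \<in> \<Omega>"
    show "0 < ?h x" using pos[OF x] .
    assume n: "norm (y - x) \<le> ?h x"
    then have y: "y \<in> cball x (?h x)" by (simp add: dist_norm norm_minus_commute)
    with cball[OF x] show "y \<in> \<Omega>" by auto
    have "\<bar>?h y - ?h x\<bar> \<le> (1 / 3) * norm (y - x)"
    proof (rule grad_bound_imp_lipschitz[of "cball x (?h x)"])
      fix z assume "z \<in> cball x (?h x)"
      then have "z \<in> \<Omega>" using cball[OF x] by auto
      then show "?h differentiable (at z)" "norm (grad ?h z) \<le> 1 / 3"
        using C_k_on_differentiable[OF C1] grad[of z] k1 by auto
    qed (use y pos[OF x] in auto)
    then show "\<bar>?h y - ?h x\<bar> \<le> norm (y - x) / 3" by simp
  qed
qed

section \<open>Continuity and support of the two kernels\<close>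

lemma kernel_bounded:
  fixes k :: "real \<Rightarrow> real"
  assumes "continuous_on {0..} k" and z: "\<And>r. 1 \<le> r \<Longrightarrow> k r = 0"
  shows "\<exists>K. \<forall>r\<ge>0. \<bar>k r\<bar> \<le> K"
proof -
  have "bounded (k ` {0..1})"
    using assms(1) by (intro compact_imp_bounded compact_continuous_image) (auto elim: continuous_on_subset)
  then obtain K where K: "\<And>r. r \<in> {0..1} \<Longrightarrow> \<bar>k r\<bar> \<le> K" by (auto simp: bounded_iff simp del: atLeastAtMost_iff)
  have "\<bar>k r\<bar> \<le> K" if "0 \<le> r" for r
    using K[of r] K[of 1] z[of r] z[of 1] that by (cases "r \<le> 1") auto
  then show ?thesis by blast
qed

lemma admissible_kernelE:
  assumes "admissible_kernel \<rho>"
  obtains c r\<^sub>0 where "0 < c" "0 < r\<^sub>0" "continuous_on {0..} \<rho>"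
    "\<And>r. 0 \<le> r \<Longrightarrow> 0 \<le> \<rho> r" "\<And>r. 1 \<le> r \<Longrightarrow> \<rho> r = 0"
    "\<And>r. 0 \<le> r \<Longrightarrow> r \<le> r\<^sub>0 \<Longrightarrow> c \<le> \<rho> r"
    "continuous_on {0..} (derived_kernel \<rho>)" "\<And>r. 1 \<le> r \<Longrightarrow> derived_kernel \<rho> r = 0"
proof -
  obtain c r\<^sub>0 R\<^sub>0 l where c: "0 < c" "0 < r\<^sub>0" "r\<^sub>0 < R\<^sub>0" "R\<^sub>0 < 1"
    and diff: "\<rho> differentiable_on {0..}" and cont': "continuous_on {0..} (kernel_deriv \<rho>)"
    and nn: "\<forall>r\<ge>0. 0 \<le> \<rho> r" and l: "((\<lambda>r. kernel_deriv \<rho> r / r) \<longlongrightarrow> l) (at_right 0)"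
    and supp: "closure {r \<in> {0..}. \<rho> r \<noteq> 0} \<subseteq> {0..<R\<^sub>0}" and low: "\<forall>r\<in>{0..r\<^sub>0}. c \<le> \<rho> r"
    using assms unfolding admissible_kernel_def by blast
  have z: "\<rho> r = 0" if "R\<^sub>0 \<le> r" for r
  proof (rule ccontr)
    assume "\<rho> r \<noteq> 0"
    then have "r \<in> closure {r \<in> {0..}. \<rho> r \<noteq> 0}"
      using that c by (intro closure_subset[THEN subsetD]) auto
    with supp that show False by auto
  qed
  \<comment> \<open>Since \<open>R\<^sub>0 < 1\<close>, the kernel vanishes on a whole neighbourhood
    of \<open>r\<close>, including the case \<open>r = 1\<close>.\<close>
  have z': "kernel_deriv \<rho> r = 0" if "1 \<le> r" for r
  proof -
    have "((\<lambda>_. 0) has_vector_derivative 0) (at r)" by simp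
    then have "(\<rho> has_vector_derivative 0) (at r)"
      by (rule has_vector_derivative_transform_within_open[of _ _ _ "{R\<^sub>0<..}"]) (use that c z in auto)
    then have "vector_derivative \<rho> (at r) = 0" by (rule vector_derivative_at)
    moreover have "at r within {0..} = at r" using that by (intro at_within_interior) auto
    ultimately show ?thesis by (simp add: kernel_deriv_def)
  qed
  have l': "((\<lambda>r. - kernel_deriv \<rho> r / r) \<longlongrightarrow> - l) (at_right 0)"
    using tendsto_minus[OF l] by simp
  have at0: "at 0 within {0..} = at_right (0::real)"
  proof -
    have "{0..} - {0} = {0<..} - {0::real}" by auto
    then show ?thesis by (simp add: at_within_def)
  qed
  \<comment> \<open>At 0 the assumed limit of the quotient is the value put into
    \<open>derived_kernel\<close>; elsewhere it is locally a quotient of continuous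
    functions.\<close>
  have "continuous (at r within {0..}) (derived_kernel \<rho>)" if r: "r \<in> {0..}" for r
  proof (cases "r = 0")
    case True
    have "(derived_kernel \<rho> \<longlongrightarrow> - l) (at_right 0)"
      by (rule Lim_transform_eventually[OF l'])
         (auto simp: derived_kernel_def eventually_at_filter)
    moreover have "derived_kernel \<rho> 0 = - l"
      using tendsto_Lim[OF _ l'] by (simp add: derived_kernel_def)
    ultimately show ?thesis by (simp add: True continuous_within at0)
  next
    case False
    have "continuous (at r within {0..}) (\<lambda>r. - kernel_deriv \<rho> r / r)"
      using cont' r False by (auto simp: continuous_on_eq_continuous_within intro!: continuous_intros)
    then have "((\<lambda>r. - kernel_deriv \<rho> r / r) \<longlongrightarrow> derived_kernel \<rho> r) (at r within {0..})"
      using False by (simp add: continuous_within derived_kernel_def)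
    moreover have "\<forall>\<^sub>F s in at r within {0..}. - kernel_deriv \<rho> s / s = derived_kernel \<rho> s"
      unfolding eventually_at_filter using t1_space_nhds[OF False]
      by eventually_elim (simp add: derived_kernel_def)
    ultimately show ?thesis by (simp add: continuous_within Lim_transform_eventually)
  qed
  then have "continuous_on {0..} (derived_kernel \<rho>)"
    by (simp add: continuous_on_eq_continuous_within)
  then show thesis
    using that[of c r\<^sub>0] c nn low z z' differentiable_imp_continuous_on[OF diff]
    by (auto simp: derived_kernel_def)
qed

section \<open>Real-valued estimates with uniform constants\<close>

lemma W_seminorm_squared: "(W_seminorm \<Omega> R h u)\<^sup>2 = enn2real (W_seminorm_sq \<Omega> R h u)"
  by (simp add: W_seminorm_def)

text \<open>Finiteness matters because \<open>enn2real\<close> sends infinity to 0 and is monotone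
  only below a finite bound.\<close>

lemma W_seminorm_le_W_norm:
  assumes "W_norm_sq \<Omega> R h u < \<infinity>"
  shows "W_seminorm \<Omega> R h u \<le> W_norm \<Omega> R h u"
  using assms unfolding W_seminorm_def W_norm_def W_norm_sq_def
  by (intro real_sqrt_le_mono enn2real_mono) auto

lemma W_seminorm_nonneg [simp]: "0 \<le> W_seminorm \<Omega> R h u"
  by (simp add: W_seminorm_def)

lemma W_seminorm_sq_le_imp_W_seminorm_le:
  assumes "W_seminorm_sq \<Omega> s h u \<le> ennreal C * W_seminorm_sq \<Omega> r h u" "W_seminorm_sq \<Omega> r h u < \<infinity>" "0 < C"
  shows "W_seminorm_sq \<Omega> s h u < \<infinity>" "W_seminorm \<Omega> s h u \<le> sqrt C * W_seminorm \<Omega> r h u"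
proof -
  have fin: "ennreal C * W_seminorm_sq \<Omega> r h u < \<infinity>"
    using assms(2) by (simp add: ennreal_mult_less_top)
  then show "W_seminorm_sq \<Omega> s h u < \<infinity>" using assms(1) by (rule le_less_trans[rotated])
  have "enn2real (W_seminorm_sq \<Omega> s h u) \<le> enn2real (ennreal C * W_seminorm_sq \<Omega> r h u)"
    using assms(1) fin by (intro enn2real_mono) auto
  also have "\<dots> = C * enn2real (W_seminorm_sq \<Omega> r h u)"
    using assms(3) by (simp add: enn2real_mult)
  finally show "W_seminorm \<Omega> s h u \<le> sqrt C * W_seminorm \<Omega> r h u"
    unfolding W_seminorm_def real_sqrt_mult[symmetric] by (rule real_sqrt_le_mono)
qed

text \<open>Combines the bound at horizon 1 with the comparison of horizons 1 and \<open>R\<close>.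
  Stated for a general kernel so as to serve \<rho> and \<open>derived_kernel \<rho>\<close>
  alike.\<close>

lemma kernel_form_bounded:
  assumes "continuous_on {0..} k" "\<And>r. 1 \<le> r \<Longrightarrow> k r = 0" "0 < R"
  shows "\<exists>C>0. \<forall>(\<Omega> :: 'a::euclidean_space set) h u v. localized_domain \<Omega> h \<longrightarrow>
    u \<in> borel_measurable (lebesgue_on \<Omega>) \<longrightarrow> v \<in> borel_measurable (lebesgue_on \<Omega>) \<longrightarrow>
    W_seminorm_sq \<Omega> R h u < \<infinity> \<longrightarrow> W_seminorm_sq \<Omega> R h v < \<infinity> \<longrightarrow>
    form_converges \<Omega> k h u v \<and> nonlocal_form \<Omega> k h u v \<le> C * W_seminorm \<Omega> R h u * W_seminorm \<Omega> R h v"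
proof -
  obtain K where K: "\<And>r. 0 \<le> r \<Longrightarrow> \<bar>k r\<bar> \<le> K" using kernel_bounded[OF assms(1,2)] by auto
  have K0: "0 \<le> K" using K[of 0] by auto
  obtain C where C: "0 < C" and cmp: "\<And>(\<Omega> :: 'a set) h u. localized_domain \<Omega> h \<Longrightarrow>
    u \<in> borel_measurable (lebesgue_on \<Omega>) \<Longrightarrow> W_seminorm_sq \<Omega> 1 h u \<le> ennreal C * W_seminorm_sq \<Omega> R h u"
    using W_seminorm_sq_horizon_comparison[OF assms(3), where 'a='a] by fastforce
  show ?thesis
  \<comment> \<open>The summand 1 keeps the constant positive when \<open>K\<close> is 0.\<close>
  proof (rule exI[of _ "K * C + 1"], intro conjI allI impI)
    show "0 < K * C + 1" using K0 C by (simp add: add_nonneg_pos)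
  next
    fix \<Omega> :: "'a set" and h and u v :: "'a \<Rightarrow> real"
    assume ld: "localized_domain \<Omega> h"
      and m: "u \<in> borel_measurable (lebesgue_on \<Omega>)" "v \<in> borel_measurable (lebesgue_on \<Omega>)"
      and fin: "W_seminorm_sq \<Omega> R h u < \<infinity>" "W_seminorm_sq \<Omega> R h v < \<infinity>"
    interpret localized_kernel \<Omega> h k K
      using ld assms K by (simp add: localized_kernel_def localized_kernel_axioms_def)
    note u = W_seminorm_sq_le_imp_W_seminorm_le[OF cmp[OF ld m(1)] fin(1) C]
    note v = W_seminorm_sq_le_imp_W_seminorm_le[OF cmp[OF ld m(2)] fin(2) C]
    show "form_converges \<Omega> k h u v" using form_converges_finite[OF m u(1) v(1)] .
    have "nonlocal_form \<Omega> k h u v \<le> K * (W_seminorm \<Omega> 1 h u * W_seminorm \<Omega> 1 h v)"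
      using nonlocal_form_le[OF m u(1) v(1)] by (simp add: mult.assoc)
    also have "\<dots> \<le> K * ((sqrt C * W_seminorm \<Omega> R h u) * (sqrt C * W_seminorm \<Omega> R h v))"
      by (intro mult_left_mono mult_mono u v K0) (use C in auto)
    also have "\<dots> = (K * C) * (W_seminorm \<Omega> R h u * W_seminorm \<Omega> R h v)"
      using C by (simp add: mult_ac flip: mult.assoc[of "sqrt C" "sqrt C"])
    also have "\<dots> \<le> (K * C + 1) * (W_seminorm \<Omega> R h u * W_seminorm \<Omega> R h v)"
      by (intro mult_right_mono) auto
    finally show "nonlocal_form \<Omega> k h u v \<le> (K * C + 1) * W_seminorm \<Omega> R h u * W_seminorm \<Omega> R h v"
      by (simp add: mult.assoc)
  qed
qed

text \<open>Horizon \<open>R\<close> is controlled by horizon \<open>r\<^sub>0\<close>, which the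
  form controls up to \<open>2 / c\<close>. The comparison of horizons 1 and \<open>R\<close> is
  used for the convergence of the form.\<close>

lemma kernel_form_coercive:
  assumes "continuous_on {0..} k" "\<And>r. 1 \<le> r \<Longrightarrow> k r = 0" "\<And>r. 0 \<le> r \<Longrightarrow> 0 \<le> k r"
    and "0 < c" "0 < r\<^sub>0" "\<And>r. 0 \<le> r \<Longrightarrow> r \<le> r\<^sub>0 \<Longrightarrow> c \<le> k r" "0 < R" "R \<le> 1"
  shows "\<exists>C>0. \<forall>(\<Omega> :: 'a::euclidean_space set) h u. localized_domain \<Omega> h \<longrightarrow>
    u \<in> borel_measurable (lebesgue_on \<Omega>) \<longrightarrow> W_seminorm_sq \<Omega> R h u < \<infinity> \<longrightarrow>
    (W_seminorm \<Omega> R h u)\<^sup>2 \<le> C * nonlocal_form \<Omega> k h u u"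
proof -
  obtain K where K: "\<And>r. 0 \<le> r \<Longrightarrow> \<bar>k r\<bar> \<le> K" using kernel_bounded[OF assms(1,2)] by auto
  obtain C where C: "0 < C" and cmp: "\<And>(\<Omega> :: 'a set) h u. localized_domain \<Omega> h \<Longrightarrow>
    u \<in> borel_measurable (lebesgue_on \<Omega>) \<Longrightarrow> W_seminorm_sq \<Omega> 1 h u \<le> ennreal C * W_seminorm_sq \<Omega> R h u"
    using W_seminorm_sq_horizon_comparison[OF assms(7), where 'a='a] by fastforce
  obtain D where D: "0 < D" and cmp0: "\<And>(\<Omega> :: 'a set) h u. localized_domain \<Omega> h \<Longrightarrow>
    u \<in> borel_measurable (lebesgue_on \<Omega>) \<Longrightarrow> W_seminorm_sq \<Omega> R h u \<le> ennreal D * W_seminorm_sq \<Omega> r\<^sub>0 h u"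
    using W_seminorm_sq_horizon_comparison[OF assms(5), where 'a='a] assms(8) by fastforce
  show ?thesis
  proof (rule exI[of _ "D * (2 / c)"], intro conjI allI impI)
    show "0 < D * (2 / c)" using D assms(4) by simp
  next
    fix \<Omega> :: "'a set" and h and u :: "'a \<Rightarrow> real"
    assume ld: "localized_domain \<Omega> h" and m: "u \<in> borel_measurable (lebesgue_on \<Omega>)"
      and fin: "W_seminorm_sq \<Omega> R h u < \<infinity>"
    interpret localized_kernel \<Omega> h k K
      using ld assms K by (simp add: localized_kernel_def localized_kernel_axioms_def)
    note u = W_seminorm_sq_le_imp_W_seminorm_le[OF cmp[OF ld m] fin C]
    let ?F = "nonlocal_form \<Omega> k h u u"
    have F: "0 \<le> ?F" and le: "ennreal (c / 2) * W_seminorm_sq \<Omega> r\<^sub>0 h u \<le> ennreal ?F"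
      using W_seminorm_sq_le_nonlocal_form[OF m u(1) assms(3,6) less_imp_le[OF assms(4)]] by blast+
    have "W_seminorm_sq \<Omega> r\<^sub>0 h u = ennreal (2 / c) * (ennreal (c / 2) * W_seminorm_sq \<Omega> r\<^sub>0 h u)"
      using assms(4) by (simp flip: mult.assoc ennreal_mult)
    also have "\<dots> \<le> ennreal (2 / c) * ennreal ?F" using le by (rule mult_left_mono) simp
    finally have "ennreal D * W_seminorm_sq \<Omega> r\<^sub>0 h u \<le> ennreal D * (ennreal (2 / c) * ennreal ?F)"
      by (rule mult_left_mono) simp
    with cmp0[OF ld m] have "W_seminorm_sq \<Omega> R h u \<le> ennreal (D * (2 / c)) * ennreal ?F"
      using D assms(4) by (simp add: ennreal_mult mult.assoc del: times_divide_eq_right)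
    then have "enn2real (W_seminorm_sq \<Omega> R h u) \<le> enn2real (ennreal (D * (2 / c)) * ennreal ?F)"
      by (intro enn2real_mono) (simp_all add: ennreal_mult_less_top)
    then show "(W_seminorm \<Omega> R h u)\<^sup>2 \<le> D * (2 / c) * ?F"
      using D F assms(4) by (simp add: W_seminorm_squared enn2real_mult)
  qed
qed

theorem theorem1p7:
  fixes \<Omega> :: "'a::euclidean_space set"
    and \<kappa>\<^sub>0 \<kappa>\<^sub>1 \<kappa>\<^sub>2 \<kappa>\<^sub>b R :: real
    and \<rho> :: "real \<Rightarrow> real"
  assumes "bounded_C2_domain \<Omega>"
    and "0 < \<kappa>\<^sub>0" and "\<kappa>\<^sub>0 < 1" and "0 < \<kappa>\<^sub>1" and "0 < \<kappa>\<^sub>2" and "0 < \<kappa>\<^sub>b"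
    and "0 < R" and "R < 1"
    and "admissible_kernel \<rho>"
  shows "\<exists>C>0. \<forall>\<eta>. localization_functions \<Omega> \<kappa>\<^sub>0 \<kappa>\<^sub>1 \<kappa>\<^sub>2 \<kappa>\<^sub>b \<eta> \<longrightarrow>
    (\<forall>\<delta>. 0 < \<delta> \<and> \<delta> < delta0 \<kappa>\<^sub>1 \<kappa>\<^sub>b \<longrightarrow>
      (\<forall>u\<in>W_space \<Omega> R (\<eta> \<delta>).
         inverse C * nonlocal_form \<Omega> \<rho> (\<eta> \<delta>) u u \<le> (W_seminorm \<Omega> R (\<eta> \<delta>) u)\<^sup>2 \<and>
         (W_seminorm \<Omega> R (\<eta> \<delta>) u)\<^sup>2 \<le> C * nonlocal_form \<Omega> \<rho> (\<eta> \<delta>) u u) \<and>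
      (\<forall>u\<in>W_space \<Omega> R (\<eta> \<delta>). \<forall>v\<in>W_space \<Omega> R (\<eta> \<delta>).
         form_converges \<Omega> \<rho> (\<eta> \<delta>) u v \<and>
         nonlocal_form \<Omega> \<rho> (\<eta> \<delta>) u v \<le> C * W_norm \<Omega> R (\<eta> \<delta>) u * W_norm \<Omega> R (\<eta> \<delta>) v) \<and>
      (\<forall>u\<in>W_space \<Omega> R (\<eta> \<delta>). \<forall>v\<in>W_space \<Omega> R (\<eta> \<delta>).
         form_converges \<Omega> (derived_kernel \<rho>) (\<eta> \<delta>) u v \<and>
         nonlocal_form \<Omega> (derived_kernel \<rho>) (\<eta> \<delta>) u v
           \<le> C * W_norm \<Omega> R (\<eta> \<delta>) u * W_norm \<Omega> R (\<eta> \<delta>) v))"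
proof -
  obtain c r\<^sub>0 where k: "0 < c" "0 < r\<^sub>0" "continuous_on {0..} \<rho>"
    "\<And>r. 0 \<le> r \<Longrightarrow> 0 \<le> \<rho> r" "\<And>r. 1 \<le> r \<Longrightarrow> \<rho> r = 0"
    "\<And>r. 0 \<le> r \<Longrightarrow> r \<le> r\<^sub>0 \<Longrightarrow> c \<le> \<rho> r"
    "continuous_on {0..} (derived_kernel \<rho>)" "\<And>r. 1 \<le> r \<Longrightarrow> derived_kernel \<rho> r = 0"
    using admissible_kernelE[OF assms(9)] by metis
  obtain C1 where C1: "0 < C1" and bdd: "\<And>h u v. localized_domain \<Omega> h \<Longrightarrow>
    u \<in> borel_measurable (lebesgue_on \<Omega>) \<Longrightarrow> v \<in> borel_measurable (lebesgue_on \<Omega>) \<Longrightarrow>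
    W_seminorm_sq \<Omega> R h u < \<infinity> \<Longrightarrow> W_seminorm_sq \<Omega> R h v < \<infinity> \<Longrightarrow>
    form_converges \<Omega> \<rho> h u v \<and> nonlocal_form \<Omega> \<rho> h u v \<le> C1 * W_seminorm \<Omega> R h u * W_seminorm \<Omega> R h v"
    using kernel_form_bounded[OF k(3,5) assms(7), where 'a='a] by blast
  obtain C2 where C2: "0 < C2" and bdd': "\<And>h u v. localized_domain \<Omega> h \<Longrightarrow>
    u \<in> borel_measurable (lebesgue_on \<Omega>) \<Longrightarrow> v \<in> borel_measurable (lebesgue_on \<Omega>) \<Longrightarrow>
    W_seminorm_sq \<Omega> R h u < \<infinity> \<Longrightarrow> W_seminorm_sq \<Omega> R h v < \<infinity> \<Longrightarrow>
    form_converges \<Omega> (derived_kernel \<rho>) h u v \<and>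
    nonlocal_form \<Omega> (derived_kernel \<rho>) h u v \<le> C2 * W_seminorm \<Omega> R h u * W_seminorm \<Omega> R h v"
    using kernel_form_bounded[OF k(7,8) assms(7), where 'a='a] by blast
  obtain C3 where C3: "0 < C3" and coercive: "\<And>h u. localized_domain \<Omega> h \<Longrightarrow>
    u \<in> borel_measurable (lebesgue_on \<Omega>) \<Longrightarrow> W_seminorm_sq \<Omega> R h u < \<infinity> \<Longrightarrow>
    (W_seminorm \<Omega> R h u)\<^sup>2 \<le> C3 * nonlocal_form \<Omega> \<rho> h u u"
    using kernel_form_coercive[OF k(3,5,4,1,2,6) assms(7) less_imp_le[OF assms(8)], where 'a='a] by blast
  define C where "C = C1 + C2 + C3"
  have C: "0 < C" "C1 \<le> C" "C2 \<le> C" "C3 \<le> C" using C1 C2 C3 by (auto simp: C_def)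
  have main: "inverse C * nonlocal_form \<Omega> \<rho> h u u \<le> (W_seminorm \<Omega> R h u)\<^sup>2"
    "(W_seminorm \<Omega> R h u)\<^sup>2 \<le> C * nonlocal_form \<Omega> \<rho> h u u"
    "form_converges \<Omega> \<rho> h u v"
    "nonlocal_form \<Omega> \<rho> h u v \<le> C * W_norm \<Omega> R h u * W_norm \<Omega> R h v"
    "form_converges \<Omega> (derived_kernel \<rho>) h u v"
    "nonlocal_form \<Omega> (derived_kernel \<rho>) h u v \<le> C * W_norm \<Omega> R h u * W_norm \<Omega> R h v"
    if ld: "localized_domain \<Omega> h" and uv: "u \<in> W_space \<Omega> R h" "v \<in> W_space \<Omega> R h" for h u v
  proof -
    have m: "u \<in> borel_measurable (lebesgue_on \<Omega>)" "v \<in> borel_measurable (lebesgue_on \<Omega>)"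
      and n: "W_norm_sq \<Omega> R h u < \<infinity>" "W_norm_sq \<Omega> R h v < \<infinity>"
      using uv by (auto simp: W_space_def)
    then have fin: "W_seminorm_sq \<Omega> R h u < \<infinity>" "W_seminorm_sq \<Omega> R h v < \<infinity>"
      by (auto simp: W_norm_sq_def)
    have mono: "a * W_seminorm \<Omega> R h u * W_seminorm \<Omega> R h v \<le> C * W_norm \<Omega> R h u * W_norm \<Omega> R h v"
      if "0 < a" "a \<le> C" for a
      using that C(1) n by (intro mult_mono W_seminorm_le_W_norm) (auto simp: W_norm_def)
    have "nonlocal_form \<Omega> \<rho> h u u \<le> C1 * (W_seminorm \<Omega> R h u)\<^sup>2"
      using bdd[OF ld m(1) m(1) fin(1) fin(1)] by (simp add: power2_eq_square mult.assoc)
    also have "\<dots> \<le> C * (W_seminorm \<Omega> R h u)\<^sup>2" using C(2) by (intro mult_right_mono) auto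
    finally show "inverse C * nonlocal_form \<Omega> \<rho> h u u \<le> (W_seminorm \<Omega> R h u)\<^sup>2"
      using C(1) by (simp add: field_simps)
    have co: "(W_seminorm \<Omega> R h u)\<^sup>2 \<le> C3 * nonlocal_form \<Omega> \<rho> h u u"
      by (rule coercive[OF ld m(1) fin(1)])
    \<comment> \<open>Nonnegativity of the form, read off from coercivity, allows \<open>C3\<close>
      to be enlarged to \<open>C\<close>.\<close>
    then have "0 \<le> nonlocal_form \<Omega> \<rho> h u u"
      using C3 by (meson order_trans zero_le_mult_iff zero_le_power2 not_less)
    then have "C3 * nonlocal_form \<Omega> \<rho> h u u \<le> C * nonlocal_form \<Omega> \<rho> h u u"
      using C(4) by (rule mult_right_mono[rotated])
    with co show "(W_seminorm \<Omega> R h u)\<^sup>2 \<le> C * nonlocal_form \<Omega> \<rho> h u u" by linarith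
    show "form_converges \<Omega> \<rho> h u v" "form_converges \<Omega> (derived_kernel \<rho>) h u v"
      using bdd[OF ld m fin] bdd'[OF ld m fin] by auto
    show "nonlocal_form \<Omega> \<rho> h u v \<le> C * W_norm \<Omega> R h u * W_norm \<Omega> R h v"
      using bdd[OF ld m fin] mono[OF C1 C(2)] by linarith
    show "nonlocal_form \<Omega> (derived_kernel \<rho>) h u v \<le> C * W_norm \<Omega> R h u * W_norm \<Omega> R h v"
      using bdd'[OF ld m fin] mono[OF C2 C(3)] by linarith
  qed
  show ?thesis
  proof (rule exI[of _ C], intro conjI[OF C(1)] allI impI)
    fix \<eta> :: "real \<Rightarrow> 'a \<Rightarrow> real" and \<delta>
    assume "localization_functions \<Omega> \<kappa>\<^sub>0 \<kappa>\<^sub>1 \<kappa>\<^sub>2 \<kappa>\<^sub>b \<eta>" and "0 < \<delta> \<and> \<delta> < delta0 \<kappa>\<^sub>1 \<kappa>\<^sub>b"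
    then have "localized_domain \<Omega> (\<eta> \<delta>)"
      using localization_functions_localized_domain assms(1,4,6) by blast
    note main = main[OF this]
    show "(\<forall>u\<in>W_space \<Omega> R (\<eta> \<delta>).
         inverse C * nonlocal_form \<Omega> \<rho> (\<eta> \<delta>) u u \<le> (W_seminorm \<Omega> R (\<eta> \<delta>) u)\<^sup>2 \<and>
         (W_seminorm \<Omega> R (\<eta> \<delta>) u)\<^sup>2 \<le> C * nonlocal_form \<Omega> \<rho> (\<eta> \<delta>) u u) \<and>
      (\<forall>u\<in>W_space \<Omega> R (\<eta> \<delta>). \<forall>v\<in>W_space \<Omega> R (\<eta> \<delta>).
         form_converges \<Omega> \<rho> (\<eta> \<delta>) u v \<and>
         nonlocal_form \<Omega> \<rho> (\<eta> \<delta>) u v \<le> C * W_norm \<Omega> R (\<eta> \<delta>) u * W_norm \<Omega> R (\<eta> \<delta>) v) \<and>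
      (\<forall>u\<in>W_space \<Omega> R (\<eta> \<delta>). \<forall>v\<in>W_space \<Omega> R (\<eta> \<delta>).
         form_converges \<Omega> (derived_kernel \<rho>) (\<eta> \<delta>) u v \<and>
         nonlocal_form \<Omega> (derived_kernel \<rho>) (\<eta> \<delta>) u v
           \<le> C * W_norm \<Omega> R (\<eta> \<delta>) u * W_norm \<Omega> R (\<eta> \<delta>) v)"
      by (intro conjI ballI) (rule main; assumption)+
  qed
qed

end
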